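(* Let $T : L^2[0,1] \to L^2[0,1]$ be a monomial operator, i.e. a bounded linear operator for which there exist constants $c_n \in \mathbb{C}$ and $p_n \in \mathbb{S}$ with $T(x^n) = c_n x^{p_n}$ for all $n \in \mathbb{N}$. Then there exist a holomorphic map $\beta : \mathbb{S} \to \mathbb{S}$ and a function $g \in H^2(\mathbb{S})$ such that for every $s \in \mathbb{S}$, $$T(x^s) = \frac{1+\beta(s)}{1+s}\, g(s)\, x^{\beta(s)}.$$ Moreover, with $\widehat{T} = U T U^* : H^2(\mathbb{S}) \to H^2(\mathbb{S})$, $$(\widehat{T}^* f)(s) = g^{\cup}(s)\, f(\beta^{\cup}(s)) \qquad \text{for all } f \in H^2(\mathbb{S}),\ s \in \mathbb{S}.$$
   Context: $\mathbb{N} = \{0,1,2,\dots\}$. $\mathbb{S} = \{ s \in \mathbb{C} : \operatorname{Re}(s) > -\tfrac12 \}$; for $s \in \mathbb{S}$, $x^s = e^{s\log x}$ is an element of $L^2[0,1]$ (complex-valued functions, Lebesgue measure). Let $\mathbb{D}$ be the open unit disk, $H^2(\mathbb{D})$ its Hardy space with norm $\|\phi\|^2 = \sup_{0<r<1} \frac{1}{2\pi}\int_0^{2\pi} |\phi(re^{i\theta})|^2 d\theta$, and let $\lambda(s) = \frac{s}{s+1}$, which maps $\mathbb{S}$ conformally onto $\mathbb{D}$. The space $H^2(\mathbb{S})$ is $\{\phi \circ \lambda : \phi \in H^2(\mathbb{D})\}$, normed so that $\phi \mapsto \phi\circ\lambda$ is unitary. Its reproducing kernel is $k_u(s) = \frac{(1+s)(1+\bar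 u)}{1+s+\bar u}$ for $s,u \in \mathbb{S}$. $U : L^2[0,1] \to H^2(\mathbb{S})$ is the unitary determined by $U(x^s) = \frac{1}{1+s} k_{\bar s}$ for $s \in \mathbb{S}$; equivalently $(Uf)(s) = (1+s)\int_0^1 f(x) x^s\,dx$. For a holomorphic function $h$ on $\mathbb{S}$, $h^{\cup}(s) = \overline{h(\bar s)}$. *)

theory Defs
  imports "HOL-Complex_Analysis.Complex_Analysis"
begin

section \<open>The space $L^2[0,1]$\<close>

text \<open>
  Elements of $L^2[0,1]$ are represented by square-integrable functions; two functions represent
  the same element iff they agree almost everywhere (\<open>L2_eq\<close>). Accordingly an operator on
  $L^2[0,1]$ is a map on representatives that respects \<open>L2_eq\<close>, and identities between
  elements are stated up to \<open>L2_eq\<close>.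
\<close>

abbreviation I01 :: "real measure" where
  "I01 \<equiv> lebesgue_on {0..1}"

definition L2 :: "(real \<Rightarrow> complex) set" where
  "L2 = {f \<in> borel_measurable I01. integrable I01 (\<lambda>x. (norm (f x))\<^sup>2)}"

definition L2_eq :: "(real \<Rightarrow> complex) \<Rightarrow> (real \<Rightarrow> complex) \<Rightarrow> bool" (infix "\<doteq>" 50) where
  "f \<doteq> g \<longleftrightarrow> (AE x in I01. f x = g x)"

definition L2_norm :: "(real \<Rightarrow> complex) \<Rightarrow> real" where
  "L2_norm f = sqrt (LINT x|I01. (norm (f x))\<^sup>2)"

definition L2_inner :: "(real \<Rightarrow> complex) \<Rightarrow> (real \<Rightarrow> complex) \<Rightarrow> complex" where
  "L2_inner f g = (LINT x|I01. f x * cnj (g x))"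

definition L2_bounded_operator :: "((real \<Rightarrow> complex) \<Rightarrow> real \<Rightarrow> complex) \<Rightarrow> bool" where
  "L2_bounded_operator T \<longleftrightarrow>
     T \<in> L2 \<rightarrow> L2 \<and>
     (\<forall>f\<in>L2. \<forall>g\<in>L2. f \<doteq> g \<longrightarrow> T f \<doteq> T g) \<and>
     (\<forall>f\<in>L2. \<forall>g\<in>L2. T (\<lambda>x. f x + g x) \<doteq> (\<lambda>x. T f x + T g x)) \<and>
     (\<forall>f\<in>L2. \<forall>c. T (\<lambda>x. c * f x) \<doteq> (\<lambda>x. c * T f x)) \<and>
     (\<exists>K. \<forall>f\<in>L2. L2_norm (T f) \<le> K * L2_norm f)"

section \<open>Monomial operators\<close>

definition half_plane :: "complex set" where
  "half_plane = {s. Re s > -1/2}"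

text \<open>
  The function $x^s$. The value at the null point $x = 0$ is \<open>0\<close> for every \<open>s\<close>
  (also for \<open>s = 0\<close>), which is irrelevant for the element of $L^2[0,1]$ it represents.
\<close>

definition xpow :: "complex \<Rightarrow> real \<Rightarrow> complex" where
  "xpow s x = complex_of_real x powr s"

definition monomial_operator :: "((real \<Rightarrow> complex) \<Rightarrow> real \<Rightarrow> complex) \<Rightarrow> bool" where
  "monomial_operator T \<longleftrightarrow>
     L2_bounded_operator T \<and>
     (\<exists>(c :: nat \<Rightarrow> complex) (p :: nat \<Rightarrow> complex).
        (\<forall>n. p n \<in> half_plane) \<and>
        (\<forall>n. T (xpow (of_nat n)) \<doteq> (\<lambda>x. c n * xpow (p n) x)))"

section \<open>Hardy spaces of the disk and of the half plane\<close>

text \<open>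
  Holomorphic functions on a domain are total functions; only their values on the domain matter,
  and the definitions below depend on those values only.
\<close>

definition circle_mean :: "(complex \<Rightarrow> complex) \<Rightarrow> real \<Rightarrow> real" where
  "circle_mean \<phi> r =
     1 / (2 * pi) * integral {0..2 * pi} (\<lambda>\<theta>. (norm (\<phi> (of_real r * exp (\<i> * of_real \<theta>))))\<^sup>2)"

definition H2_disk :: "(complex \<Rightarrow> complex) set" where
  "H2_disk = {\<phi>. \<phi> holomorphic_on ball 0 1 \<and> bdd_above (circle_mean \<phi> ` {0<..<1})}"

definition H2_disk_norm :: "(complex \<Rightarrow> complex) \<Rightarrow> real" where
  "H2_disk_norm \<phi> = sqrt (SUP r\<in>{0<..<1}. circle_mean \<phi> r)"

definition lam :: "complex \<Rightarrow> complex" where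
  "lam s = s / (s + 1)"

lemma bij_betw_lam: "bij_betw lam half_plane (ball 0 1)"
proof (rule bij_betw_byWitness[where f' = "\<lambda>z. z / (1 - z)"])
  have ne: "s + 1 \<noteq> 0" if "s \<in> half_plane" for s
  proof
    assume "s + 1 = 0"
    then have "Re s = - 1" by (metis add_eq_0_iff2 one_complex.sel(1) uminus_complex.sel(1))
    then show False using that by (simp add: half_plane_def)
  qed
  show "\<forall>s\<in>half_plane. lam s / (1 - lam s) = s"
  proof
    fix s assume s: "s \<in> half_plane"
    have "1 - lam s = 1 / (s + 1)" using ne[OF s] by (simp add: lam_def divide_simps)
    then show "lam s / (1 - lam s) = s"
      using ne[OF s] by (simp add: lam_def)
  qed
  show "\<forall>z\<in>ball 0 1. lam (z / (1 - z)) = z"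
  proof
    fix z :: complex assume "z \<in> ball 0 1"
    then have z: "1 - z \<noteq> 0" by auto
    then have "z / (1 - z) + 1 = 1 / (1 - z)" by (simp add: field_simps)
    then show "lam (z / (1 - z)) = z" using z by (simp add: lam_def)
  qed
  show "lam ` half_plane \<subseteq> ball 0 1"
  proof
    fix w assume "w \<in> lam ` half_plane"
    then obtain s where s: "s \<in> half_plane" "w = lam s" by blast
    have "(norm s)\<^sup>2 < (norm (s + 1))\<^sup>2"
      using s(1) unfolding cmod_power2 by (simp add: half_plane_def power2_eq_square algebra_simps)
    then have "norm s < norm (s + 1)" by (rule power2_less_imp_less) simp
    then show "w \<in> ball 0 1"
      using ne[OF s(1)] by (simp add: s(2) lam_def norm_divide)
  qed
  show "(\<lambda>z. z / (1 - z)) ` ball 0 1 \<subseteq> half_plane"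
  proof
    fix s :: complex assume "s \<in> (\<lambda>z. z / (1 - z)) ` ball 0 1"
    then obtain z :: complex where z: "norm z < 1" "s = z / (1 - z)" by auto
    then have nz: "1 - z \<noteq> 0" by auto
    have "norm s < norm (s + 1)"
    proof -
      have "s + 1 = 1 / (1 - z)" using nz z by (simp add: field_simps)
      then show ?thesis using nz z by (simp add: norm_divide divide_strict_right_mono)
    qed
    then have "(norm s)\<^sup>2 < (norm (s + 1))\<^sup>2" by (simp add: power_strict_mono)
    then show "s \<in> half_plane"
      unfolding cmod_power2 by (simp add: half_plane_def power2_eq_square algebra_simps)
  qed
qed

definition H2_half_plane :: "(complex \<Rightarrow> complex) set" where
  "H2_half_plane = {h. \<exists>\<phi>\<in>H2_disk. \<forall>s\<in>half_plane. h s = \<phi> (lam s)}"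

definition H2_half_plane_norm :: "(complex \<Rightarrow> complex) \<Rightarrow> real" where
  "H2_half_plane_norm h = H2_disk_norm (h \<circ> inv_into half_plane lam)"

text \<open>
  The inner product inducing the norm, recovered by polarization; like \<open>L2_inner\<close> it is
  linear in the first argument.
\<close>

definition H2_half_plane_inner :: "(complex \<Rightarrow> complex) \<Rightarrow> (complex \<Rightarrow> complex) \<Rightarrow> complex" where
  "H2_half_plane_inner g h =
     1 / 4 * (\<Sum>k<4. \<i> ^ k * of_real ((H2_half_plane_norm (\<lambda>s. g s + \<i> ^ k * h s))\<^sup>2))"

section \<open>Adjoints and the unitary \<open>U\<close>\<close>

text \<open>
  The Hilbert space adjoint of \<open>A\<close>, from a space with carrier \<open>X\<close> and inner product \<open>ipX\<close> to one
  with inner product \<open>ipY\<close>. As for \<^const>\<open>adjoint\<close> a representative is chosen; it is unique as an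
  element of \<open>X\<close>, that is, up to equality almost everywhere resp. on the half plane.
\<close>

definition hilbert_adjoint ::
  "'a set \<Rightarrow> ('a \<Rightarrow> 'a \<Rightarrow> complex) \<Rightarrow> ('b \<Rightarrow> 'b \<Rightarrow> complex) \<Rightarrow> ('a \<Rightarrow> 'b) \<Rightarrow> 'b \<Rightarrow> 'a" where
  "hilbert_adjoint X ipX ipY A y = (SOME x. x \<in> X \<and> (\<forall>z\<in>X. ipY (A z) y = ipX z x))"

definition U :: "(real \<Rightarrow> complex) \<Rightarrow> complex \<Rightarrow> complex" where
  "U f s = (1 + s) * (LINT x|I01. f x * xpow s x)"

definition U_adj :: "(complex \<Rightarrow> complex) \<Rightarrow> real \<Rightarrow> complex" where
  "U_adj = hilbert_adjoint L2 L2_inner H2_half_plane_inner U"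

definition hat :: "((real \<Rightarrow> complex) \<Rightarrow> real \<Rightarrow> complex) \<Rightarrow> (complex \<Rightarrow> complex) \<Rightarrow> complex \<Rightarrow> complex" where
  "hat T = U \<circ> T \<circ> U_adj"

definition hat_adj :: "((real \<Rightarrow> complex) \<Rightarrow> real \<Rightarrow> complex) \<Rightarrow> (complex \<Rightarrow> complex) \<Rightarrow> complex \<Rightarrow> complex" where
  "hat_adj T = hilbert_adjoint H2_half_plane H2_half_plane_inner H2_half_plane_inner (hat T)"

definition conj_refl :: "(complex \<Rightarrow> complex) \<Rightarrow> complex \<Rightarrow> complex" where
  "conj_refl h s = cnj (h (cnj s))"

end

theory Submission
  imports Defs
begin

text \<open>
  Everything is read off from the function \<open>F s t\<close>, the integral of \<open>T(x\<^sup>s) x\<^sup>t\<close> over \<open>[0,1]\<close>,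
  which is holomorphic in each of its arguments. The Mellin transform of \<open>c x\<^sup>p\<close> is
  \<open>t \<mapsto> c / (1 + p + t)\<close>, and a function of \<open>t\<close> of this form satisfies the polynomial identity
  \<open>F s t * ((1 - t) * F s 1 + t * F s 0) = F s 0 * F s 1\<close>. By hypothesis it holds whenever \<open>s\<close> is a
  natural number. Since \<open>T\<close> has an adjoint, \<open>F s t\<close> for fixed \<open>t\<close> is the Mellin transform of
  a fixed \<open>L\<^sup>2\<close> function at \<open>s\<close>, so both sides are products of two Mellin transforms. Such a product
  depends linearly on the function \<open>u \<mapsto> u\<^sup>s\<close>, through the integral of \<open>(x y)\<^sup>s a(x) b(y)\<close>, and
  for \<open>Re s > 0\<close> this function is a uniform limit of polynomials on \<open>[0,1]\<close>. Hence an identity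
  between such products that holds at all naturals holds for \<open>Re s > 0\<close>, and by analytic
  continuation on the whole half plane (\<open>mellin_product_eq\<close>).

  Given the identity for all \<open>s\<close> and \<open>t\<close>, the quotient \<open>\<psi> s = 2 - F s 0 / F s 1\<close>, which is
  \<open>\<lambda>(p)\<close> when \<open>T(x\<^sup>s)\<close> is a nonzero multiple of \<open>x\<^sup>p\<close>, satisfies
  \<open>F s t * (1 + t * (1 - \<psi> s)) = F s 0\<close>. If \<open>\<bar>\<psi> s\<bar> > 1\<close>, then \<open>t = 1 / (\<psi> s - 1)\<close> lies in
  the half plane and makes the left side zero, so that \<open>F s 0 = 0\<close>. Hence \<open>\<psi>\<close> is bounded by 1 away from the zeros of
  \<open>F s 0 * F s 1\<close>, its singularities there are removable, and the maximum principle gives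
  \<open>\<bar>\<psi>\<bar> < 1\<close>, because this is so at every natural number with nonzero coefficient; if there is
  none, \<open>F\<close> vanishes and so does \<open>T(x\<^sup>s)\<close>. Then \<open>\<beta> = \<lambda>\<^sup>-\<^sup>1 \<circ> \<psi>\<close> is the required
  map, \<open>g s = (1 + s) * F s 0\<close>, and the formula for \<open>T(x\<^sup>s)\<close> follows because an \<open>L\<^sup>2\<close> function
  is determined by its moments (\<open>L2_eqI_moments\<close>).

  For the second claim, \<open>U\<close> maps the orthonormal basis of Laguerre functions to the powers of
  \<open>\<lambda>\<close>. In these coordinates \<open>U\<close> is unitary onto the Hardy space, the adjoint of the transferred
  operator is \<open>U T\<^sup>* U\<^sup>*\<close>, and pairing \<open>T\<^sup>* y\<close> with \<open>x\<^sup>s\<close> turns the formula for \<open>T(x\<^sup>s)\<close> into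
  the weighted composition formula (\<open>hat_adj_weighted_composition\<close>).
\<close>

section \<open>Powers and logarithms on the unit interval\<close>

lemma half_plane_add: "s \<in> half_plane \<Longrightarrow> t \<in> half_plane \<Longrightarrow> 1 + s + t \<noteq> 0"
  by (auto simp: half_plane_def complex_eq_iff)

lemma half_plane_1: "s \<in> half_plane \<Longrightarrow> 1 + s \<noteq> 0"
  by (auto simp: half_plane_def complex_eq_iff)

lemma half_plane_of_nat [simp]: "of_nat n \<in> half_plane"
  by (simp add: half_plane_def)

lemma half_plane_0 [simp]: "0 \<in> half_plane" and half_plane_one [simp]: "1 \<in> half_plane"
  by (simp_all add: half_plane_def)

lemma half_plane_cnj [simp]: "cnj s \<in> half_plane \<longleftrightarrow> s \<in> half_plane"
  by (simp add: half_plane_def)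

lemma open_half_plane: "open half_plane"
  unfolding half_plane_def by (rule open_halfspace_Re_gt)

lemma connected_half_plane: "connected half_plane"
  unfolding half_plane_def by (rule convex_connected) (rule convex_halfspace_Re_gt)

lemma xpow_0 [simp]: "xpow s 0 = 0"
  by (simp add: xpow_def)

lemma cnj_xpow: "0 \<le> x \<Longrightarrow> cnj (xpow s x) = xpow (cnj s) x"
  by (auto simp: xpow_def powr_def exp_cnj Ln_of_real)

lemma xpow_add: "xpow s x * xpow t x = xpow (s + t) x"
  by (simp add: xpow_def powr_add)

lemma xpow_mult: "0 \<le> x \<Longrightarrow> 0 \<le> y \<Longrightarrow> xpow s (x * y) = xpow s x * xpow s y"
  by (simp add: xpow_def powr_times_real)

lemma xpow_of_nat: "0 < x \<Longrightarrow> xpow (of_nat n) x = of_real (x ^ n)"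
  by (simp add: xpow_def powr_nat')

lemma norm_xpow: "0 \<le> x \<Longrightarrow> norm (xpow s x) = x powr Re s"
  by (simp add: xpow_def norm_powr_real_powr)

lemma xpow_has_vector_derivative:
  assumes "0 < x"
  shows "(xpow s has_vector_derivative s * xpow (s - 1) x) (at x)"
  unfolding xpow_def
  by (rule field_vector_diff_chain_at[of of_real 1 x "\<lambda>z. z powr s", simplified o_def, simplified])
     (use assms in \<open>auto intro!: derivative_eq_intros has_vector_derivative_of_real simp: field_simps\<close>)

lemma continuous_on_xpow_ln:
  assumes "0 < Re s"
  shows "continuous_on {0..1} (\<lambda>x. of_real (ln x ^ k) * xpow s x)"
  unfolding continuous_on_eq_continuous_within
proof
  fix x :: real assume x: "x \<in> {0..1}"
  show "continuous (at x within {0..1}) (\<lambda>x. of_real (ln x ^ k) * xpow s x)"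
  proof (cases "x = 0")
    case False
    with x have "0 < x" by simp
    then have "isCont (\<lambda>x. of_real (ln x ^ k) * xpow s x) x"
      using has_vector_derivative_continuous[OF xpow_has_vector_derivative[of x s]]
      by (intro isCont_mult isCont_of_real isCont_power isCont_ln) simp_all
    then show ?thesis by (rule continuous_at_imp_continuous_at_within)
  next
    case True
    have "LIM x at_right 0. Re s * - ln x :> at_top"
      by (rule filterlim_tendsto_pos_mult_at_top[OF tendsto_const assms])
         (simp add: filterlim_uminus_at_top ln_at_0)
    from filterlim_compose[OF tendsto_power_div_exp_0 this, of k]
    have "((\<lambda>x. 1 / Re s ^ k * ((Re s * - ln x) ^ k / exp (Re s * - ln x))) \<longlongrightarrow> 0) (at_right 0)"
      by (rule tendsto_mult_right_zero)
    then have "((\<lambda>x. (- ln x) ^ k * x powr Re s) \<longlongrightarrow> 0) (at_right 0)"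
      by (rule Lim_transform_eventually)
         (use assms in \<open>simp add: eventually_at_filter powr_def exp_minus power_mult_distrib[of "Re s" "- ln _", simplified] divide_inverse\<close>)
    then have "((\<lambda>x. \<bar>(- ln x) ^ k * x powr Re s\<bar>) \<longlongrightarrow> 0) (at_right 0)"
      by (rule tendsto_rabs_zero)
    then have "((\<lambda>x. norm (of_real (ln x ^ k) * xpow s x)) \<longlongrightarrow> 0) (at_right 0)"
      by (rule Lim_transform_eventually)
         (auto simp: eventually_at_filter norm_mult norm_xpow power_abs abs_mult norm_power)
    then have "((\<lambda>x. of_real (ln x ^ k) * xpow s x) \<longlongrightarrow> 0) (at_right 0)"
      by (rule tendsto_norm_zero_cancel)
    then have "((\<lambda>x. of_real (ln x ^ k) * xpow s x) \<longlongrightarrow> 0) (at 0 within {0..1})"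
      by (rule tendsto_mono[rotated]) (simp add: at_within_Icc_at_right)
    then show ?thesis using True by (simp add: continuous_within)
  qed
qed

text \<open>
  Integrating the derivative of \<open>(ln x)\<^sup>k\<^sup>+\<^sup>1 x\<^sup>s\<^sup>+\<^sup>1\<close>, which vanishes at both ends of the interval,
  relates the integrals for \<open>k + 1\<close> and \<open>k\<close>.
\<close>

lemma has_integral_ln_xpow:
  assumes "-1 < Re s"
  shows "((\<lambda>x. of_real (ln x ^ k) * xpow s x) has_integral (-1) ^ k * fact k / (1 + s) ^ Suc k) {0..1}"
proof (induction k)
  have nz: "1 + s \<noteq> 0" using assms by (auto simp: complex_eq_iff)
  case 0
  have "((\<lambda>x. xpow s x) has_integral (xpow (s+1) 1 / (1 + s) - xpow (s+1) 0 / (1 + s))) {0..1}"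
  proof (rule fundamental_theorem_of_calculus_interior)
    show "continuous_on {0..1} (\<lambda>a. xpow (s + 1) a / (1 + s))"
      using continuous_on_xpow_ln[of "s + 1" 0] assms nz by (auto intro!: continuous_intros)
    show "((\<lambda>a. xpow (s + 1) a / (1 + s)) has_vector_derivative xpow s x) (at x)"
      if "x \<in> {0<..<1}" for x
      using has_vector_derivative_divide[OF xpow_has_vector_derivative[of x "s+1"], of "1+s"] that nz
      by (simp add: add.commute)
  qed auto
  then show ?case using nz by (simp add: xpow_def)
next
  have nz: "1 + s \<noteq> 0" using assms by (auto simp: complex_eq_iff)
  case (Suc k)
  let ?F = "\<lambda>x. of_real (ln x ^ Suc k) * xpow (s + 1) x"
  have "((\<lambda>x. of_real (ln x ^ Suc k) * ((s + 1) * xpow s x) + of_real (of_nat (Suc k) * ln x ^ k / x) * xpow (s + 1) x)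
     has_integral ?F 1 - ?F 0) {0..1}"
  proof (rule fundamental_theorem_of_calculus_interior)
    show "continuous_on {0..1} ?F"
      using continuous_on_xpow_ln[of "s + 1" "Suc k"] assms by auto
    fix x :: real assume x: "x \<in> {0<..<1}"
    have "((\<lambda>x. ln x ^ Suc k) has_field_derivative (of_nat (Suc k) * ln x ^ k / x)) (at x)"
      using x by (auto intro!: derivative_eq_intros simp del: power_Suc)
    then have 1: "((\<lambda>x. complex_of_real (ln x ^ Suc k)) has_vector_derivative of_real (of_nat (Suc k) * ln x ^ k / x)) (at x)"
      by (intro has_vector_derivative_of_real)
         (simp add: has_real_derivative_iff_has_vector_derivative)
    show "(?F has_vector_derivative (of_real (ln x ^ Suc k) * ((s + 1) * xpow s x) + of_real (of_nat (Suc k) * ln x ^ k / x) * xpow (s + 1) x)) (at x)"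
      using has_vector_derivative_mult[OF 1 xpow_has_vector_derivative[of x "s+1"]] x
      by simp
  qed auto
  then have *: "((\<lambda>x. (s + 1) * (of_real (ln x ^ Suc k) * xpow s x) + of_nat (Suc k) * (of_real (ln x ^ k) * xpow s x))
     has_integral ?F 1 - ?F 0) {0..1}"
  proof (rule has_integral_eq[rotated])
    have xp: "xpow (s + 1) x = x * xpow s x" if "x > 0" for x
      using that by (simp add: xpow_def powr_add)
    show "of_real (ln x ^ Suc k) * ((s + 1) * xpow s x) + of_real (of_nat (Suc k) * ln x ^ k / x) * xpow (s + 1) x =
      (s + 1) * (of_real (ln x ^ Suc k) * xpow s x) + of_nat (Suc k) * (of_real (ln x ^ k) * xpow s x)" 
      if "x \<in> {0..1}" for x
      using that by (cases "x = 0") (auto simp: xp)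
  qed
  have "?F 1 - ?F 0 = 0" by simp
  from has_integral_diff[OF *[unfolded this] has_integral_mult_right[OF Suc.IH, of "of_nat (Suc k)"]]
  have "((\<lambda>x. (s + 1) * (of_real (ln x ^ Suc k) * xpow s x)) has_integral (- (of_nat (Suc k) * ((-1) ^ k * fact k / (1 + s) ^ Suc k)))) {0..1}"
    by simp
  from has_integral_mult_right[OF this, of "1 / (1+s)"]
  have "((\<lambda>x. 1 / (1 + s) * ((s + 1) * (of_real (ln x ^ Suc k) * xpow s x))) has_integral
     1 / (1 + s) * - (of_nat (Suc k) * ((-1) ^ k * fact k / (1 + s) ^ Suc k))) {0..1}" .
  moreover have "1 / (1 + s) * ((s + 1) * X) = X" for X
    using nz by (simp add: add.commute)
  moreover have "1 / (1 + s) * - (of_nat (Suc k) * ((-1) ^ k * fact k / (1 + s) ^ Suc k)) =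
      (-1) ^ Suc k * fact (Suc k) / (1 + s) ^ Suc (Suc k)"
    by simp
  ultimately show ?case by (simp only:)
qed

text \<open>
  On \<open>[0,1]\<close> the logarithm has a constant sign, so the norm of the integrand is up to the sign
  \<open>(-1)\<^sup>k\<close> an integrand of the same kind with a real exponent. Hence the gauge integral is absolute.
\<close>

lemma integrable_ln_xpow:
  assumes "-1 < Re s"
  shows "integrable I01 (\<lambda>x. of_real (ln x ^ k) * xpow s x)"
proof (rule absolutely_integrable_imp_integrable)
  have 1: "norm (of_real (ln x ^ k) * xpow s x) = Re ((-1)^k * (of_real (ln x ^ k) * xpow (of_real (Re s)) x))"
    if "x \<in> {0..1}" for x
  proof (cases "x = 0")
    case False
    then have x: "0 < x" "x \<le> 1" using that by auto
    have "norm (of_real (ln x ^ k) * xpow s x) = (- ln x) ^ k * x powr (Re s)"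
      using x by (simp add: norm_mult norm_xpow norm_power)
    also have "(- ln x) ^ k = (-1)^k * ln x ^ k" by (rule power_minus)
    also have "(-1)^k * ln x ^ k * x powr (Re s) = Re (of_real ((-1)^k * ln x ^ k * x powr (Re s)))"
      by simp
    also have "of_real ((-1)^k * ln x ^ k * x powr (Re s)) = (-1)^k * (of_real (ln x ^ k) * xpow (of_real (Re s)) x)"
      using x by (simp add: xpow_def powr_of_real)
    finally show ?thesis .
  qed simp
  have "(\<lambda>x. Re ((-1)^k * (of_real (ln x ^ k) * xpow (of_real (Re s)) x))) integrable_on {0..1}"
    using has_integral_Re[OF has_integral_mult_right[OF has_integral_ln_xpow[of "of_real (Re s)" k], of "(-1)^k"]] assms
    by (auto simp: integrable_on_def)
  then have "(\<lambda>x. norm (of_real (ln x ^ k) * xpow s x)) integrable_on {0..1}"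
    by (rule integrable_eq) (rule 1[symmetric])
  then show "(\<lambda>x. of_real (ln x ^ k) * xpow s x) absolutely_integrable_on {0..1}"
    unfolding absolutely_integrable_on_def using has_integral_ln_xpow[OF assms] by (auto simp: integrable_on_def)
qed simp

lemma integral_ln_xpow:
  assumes "-1 < Re s"
  shows "(LINT x|I01. of_real (ln x ^ k) * xpow s x) = (-1) ^ k * fact k / (1 + s) ^ Suc k"
  using lebesgue_integral_eq_integral[OF integrable_ln_xpow[OF assms]] has_integral_ln_xpow[OF assms]
  by (simp add: integral_unique)

lemma integral_xpow: "-1 < Re s \<Longrightarrow> (LINT x|I01. xpow s x) = 1 / (1 + s)"
  using integral_ln_xpow[of s 0] by simp

section \<open>The Hilbert space \<open>L\<^sup>2[0,1]\<close>\<close>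

lemma finite_measure_I01: "finite_measure I01"
  by (rule finite_measure_lebesgue_on) simp

lemma L2_measurable: "f \<in> L2 \<Longrightarrow> f \<in> borel_measurable I01"
  and L2_integrable_sq: "f \<in> L2 \<Longrightarrow> integrable I01 (\<lambda>x. (norm (f x))\<^sup>2)"
  by (simp_all add: L2_def)

lemma L2_add:
  assumes "f \<in> L2" "g \<in> L2"
  shows "(\<lambda>x. f x + g x) \<in> L2"
proof -
  note [measurable] = L2_measurable[OF assms(1)] L2_measurable[OF assms(2)]
  have "integrable I01 (\<lambda>x. (norm (f x + g x))\<^sup>2)"
  proof (rule Bochner_Integration.integrable_bound)
    show "integrable I01 (\<lambda>x. 2 * (norm (f x))\<^sup>2 + 2 * (norm (g x))\<^sup>2)"
      using assms by (intro Bochner_Integration.integrable_add integrable_mult_right L2_integrable_sq)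
    show "AE x in I01. norm ((norm (f x + g x))\<^sup>2) \<le> norm (2 * (norm (f x))\<^sup>2 + 2 * (norm (g x))\<^sup>2)"
    proof (rule AE_I2)
      fix x
      have "(norm (f x + g x))\<^sup>2 \<le> (norm (f x) + norm (g x))\<^sup>2"
        by (intro power_mono norm_triangle_ineq) auto
      also have "\<dots> \<le> 2 * (norm (f x))\<^sup>2 + 2 * (norm (g x))\<^sup>2"
        using sum_squares_bound[of "norm (f x)" "norm (g x)"] by (simp add: power2_sum)
      finally show "norm ((norm (f x + g x))\<^sup>2) \<le> norm (2 * (norm (f x))\<^sup>2 + 2 * (norm (g x))\<^sup>2)"
        by simp
    qed
  qed measurable
  then show ?thesis by (simp add: L2_def)
qed

lemma L2_cmult: "f \<in> L2 \<Longrightarrow> (\<lambda>x. c * f x) \<in> L2"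
  by (auto simp: L2_def norm_mult power_mult_distrib)

lemma L2_cnj: "f \<in> L2 \<Longrightarrow> (\<lambda>x. cnj (f x)) \<in> L2"
  unfolding L2_def
  by (auto intro: measurable_compose[OF _ borel_measurable_continuous_onI] continuous_intros)

lemma L2_diff: "f \<in> L2 \<Longrightarrow> g \<in> L2 \<Longrightarrow> (\<lambda>x. f x - g x) \<in> L2"
  using L2_add[OF _ L2_cmult[of g "-1"], of f] by simp

lemma L2_zero: "(\<lambda>x. 0) \<in> L2"
  by (simp add: L2_def)

lemma L2_sum: "(\<And>i. i \<in> A \<Longrightarrow> f i \<in> L2) \<Longrightarrow> (\<lambda>x. \<Sum>i\<in>A. f i x) \<in> L2"
proof (induction A rule: infinite_finite_induct)
  case (insert i A)
  then show ?case using L2_add[of "f i" "\<lambda>x. \<Sum>i\<in>A. f i x"] by simp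
qed (simp_all add: L2_zero)

lemma L2_integrable_mult:
  assumes "f \<in> L2" "g \<in> L2"
  shows "integrable I01 (\<lambda>x. f x * g x)"
proof (rule Bochner_Integration.integrable_bound)
  note [measurable] = L2_measurable[OF assms(1)] L2_measurable[OF assms(2)]
  show "integrable I01 (\<lambda>x. (norm (f x))\<^sup>2 + (norm (g x))\<^sup>2)"
    using assms by (intro Bochner_Integration.integrable_add L2_integrable_sq)
  show "(\<lambda>x. f x * g x) \<in> borel_measurable I01" by measurable
  have "norm (f x * g x) \<le> (norm (f x))\<^sup>2 + (norm (g x))\<^sup>2" for x
    using sum_squares_bound[of "norm (f x)" "norm (g x)"] mult_nonneg_nonneg[OF norm_ge_zero[of "f x"] norm_ge_zero[of "g x"]]
    unfolding norm_mult by linarith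
  then show "AE x in I01. norm (f x * g x) \<le> norm ((norm (f x))\<^sup>2 + (norm (g x))\<^sup>2)"
    by (intro AE_I2) simp
qed

lemma L2_integrable: "f \<in> L2 \<Longrightarrow> integrable I01 f"
  using L2_integrable_mult[of f "\<lambda>x. 1"] finite_measure.integrable_const[OF finite_measure_I01, of 1]
  by (simp add: L2_def)

lemma L2_integrable_cnj: "f \<in> L2 \<Longrightarrow> g \<in> L2 \<Longrightarrow> integrable I01 (\<lambda>x. f x * cnj (g x))"
  using L2_integrable_mult L2_cnj by blast

lemma L2_norm_nonneg: "0 \<le> L2_norm f"
  by (simp add: L2_norm_def)

lemma L2_norm_sq: "(L2_norm f)\<^sup>2 = (LINT x|I01. (norm (f x))\<^sup>2)"
  by (simp add: L2_norm_def)

lemma L2_inner_self: "L2_inner f f = of_real ((L2_norm f)\<^sup>2)"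
proof -
  have "f x * cnj (f x) = of_real ((norm (f x))\<^sup>2)" for x
    by (simp add: complex_norm_square[symmetric] mult.commute del: of_real_power)
  then show ?thesis unfolding L2_inner_def L2_norm_sq by (simp only: integral_complex_of_real)
qed

lemma L2_inner_commute: "L2_inner g f = cnj (L2_inner f g)"
  unfolding L2_inner_def by (simp add: mult.commute flip: Bochner_Integration.integral_cnj)

lemma L2_inner_add_left:
  "f \<in> L2 \<Longrightarrow> g \<in> L2 \<Longrightarrow> h \<in> L2 \<Longrightarrow> L2_inner (\<lambda>x. f x + g x) h = L2_inner f h + L2_inner g h"
  by (simp add: L2_inner_def distrib_right L2_integrable_cnj)

lemma L2_inner_diff_left:
  "f \<in> L2 \<Longrightarrow> g \<in> L2 \<Longrightarrow> h \<in> L2 \<Longrightarrow> L2_inner (\<lambda>x. f x - g x) h = L2_inner f h - L2_inner g h"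
  by (simp add: L2_inner_def left_diff_distrib L2_integrable_cnj)

lemma L2_inner_cmult_left: "L2_inner (\<lambda>x. c * f x) h = c * L2_inner f h"
  by (simp add: L2_inner_def mult.assoc)

lemma L2_inner_sum_left:
  assumes "\<And>i. i \<in> A \<Longrightarrow> f i \<in> L2" "h \<in> L2"
  shows "L2_inner (\<lambda>x. \<Sum>i\<in>A. f i x) h = (\<Sum>i\<in>A. L2_inner (f i) h)"
  unfolding L2_inner_def sum_distrib_right
  by (rule Bochner_Integration.integral_sum) (simp add: assms L2_integrable_cnj)

lemma L2_inner_diff_right:
  assumes "f \<in> L2" "g \<in> L2" "h \<in> L2"
  shows "L2_inner h (\<lambda>x. f x - g x) = L2_inner h f - L2_inner h g"
  using arg_cong[OF L2_inner_diff_left[of f g h], of cnj] assms by (simp add: L2_inner_commute[symmetric])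

lemma L2_integral_cong:
  assumes "f \<doteq> f'" "f \<in> L2" "f' \<in> L2" "h \<in> L2"
  shows "(LINT x|I01. f x * h x) = (LINT x|I01. f' x * h x)"
proof (rule integral_cong_AE)
  show "AE x in I01. f x * h x = f' x * h x" using assms(1) unfolding L2_eq_def by eventually_elim simp
qed (use assms L2_integrable_mult in \<open>blast intro: borel_measurable_integrable\<close>)+

lemma L2_inner_cong: 
  "f \<doteq> f' \<Longrightarrow> f \<in> L2 \<Longrightarrow> f' \<in> L2 \<Longrightarrow> h \<in> L2 \<Longrightarrow> L2_inner f h = L2_inner f' h"
  unfolding L2_inner_def by (rule L2_integral_cong) (auto intro: L2_cnj)

lemma L2_Cauchy_Schwarz:
  assumes "f \<in> L2" "g \<in> L2"
  shows "norm (L2_inner f g) \<le> L2_norm f * L2_norm g"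
proof -
  note [measurable] = L2_measurable[OF assms(1)] L2_measurable[OF assms(2)]
  have i: "integrable I01 (\<lambda>x. norm (f x) * norm (g x))"
    using integrable_norm[OF L2_integrable_mult[OF assms]] by (simp add: norm_mult)
  have n: "0 \<le> (LINT x|I01. norm (f x) * norm (g x))" by (rule integral_nonneg_AE) simp
  have "(\<integral>\<^sup>+x. ennreal (norm (f x)) * ennreal (norm (g x)) \<partial>I01)\<^sup>2 
      \<le> (\<integral>\<^sup>+x. (ennreal (norm (f x)))\<^sup>2 \<partial>I01) * (\<integral>\<^sup>+x. (ennreal (norm (g x)))\<^sup>2 \<partial>I01)"
    by (rule Cauchy_Schwarz_nn_integral) measurable
  also have "(\<integral>\<^sup>+x. ennreal (norm (f x)) * ennreal (norm (g x)) \<partial>I01) = ennreal (LINT x|I01. norm (f x) * norm (g x))"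
    using nn_integral_eq_integral[OF i] by (simp add: ennreal_mult)
  also have "(\<integral>\<^sup>+x. (ennreal (norm (f x)))\<^sup>2 \<partial>I01) = ennreal ((L2_norm f)\<^sup>2)"
    using nn_integral_eq_integral[OF L2_integrable_sq[OF assms(1)]] by (simp add: ennreal_power L2_norm_sq)
  also have "(\<integral>\<^sup>+x. (ennreal (norm (g x)))\<^sup>2 \<partial>I01) = ennreal ((L2_norm g)\<^sup>2)"
    using nn_integral_eq_integral[OF L2_integrable_sq[OF assms(2)]] by (simp add: ennreal_power L2_norm_sq)
  finally have "(LINT x|I01. norm (f x) * norm (g x))\<^sup>2 \<le> (L2_norm f * L2_norm g)\<^sup>2"
    using n by (simp add: ennreal_power ennreal_mult[symmetric] power_mult_distrib)
  then have "(LINT x|I01. norm (f x) * norm (g x)) \<le> L2_norm f * L2_norm g"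
    by (rule power2_le_imp_le) (simp add: L2_norm_nonneg)
  moreover have "norm (L2_inner f g) \<le> (LINT x|I01. norm (f x) * norm (g x))"
    unfolding L2_inner_def using integral_norm_bound[of I01 "\<lambda>x. f x * cnj (g x)"] by (simp add: norm_mult)
  ultimately show ?thesis by simp
qed

lemma L2_ln_xpow:
  assumes "s \<in> half_plane"
  shows "(\<lambda>x. of_real (ln x ^ k) * xpow s x) \<in> L2"
proof -
  have *: "integrable I01 (\<lambda>x. Re (of_real (ln x ^ (2 * k)) * xpow (of_real (2 * Re s)) x))"
    using assms by (intro integrable_Re integrable_ln_xpow) (simp add: half_plane_def)
  have "integrable I01 (\<lambda>x. (norm (of_real (ln x ^ k) * xpow s x))\<^sup>2)"
  proof (rule Bochner_Integration.integrable_cong[THEN iffD1, OF refl _ *])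
    fix x assume "x \<in> space I01"
    then have x: "0 \<le> x" by simp
    have "(norm (of_real (ln x ^ k) * xpow s x))\<^sup>2 = (ln x)^(2*k) * (x powr Re s)\<^sup>2"
    proof -
      have "(\<bar>ln x\<bar> ^ k)\<^sup>2 = (\<bar>ln x\<bar>\<^sup>2) ^ k" by (simp only: power_mult[symmetric] mult.commute)
      then have "(\<bar>ln x\<bar> ^ k)\<^sup>2 = ln x ^ (2 * k)" by (simp only: power2_abs power_mult)
      then show ?thesis using x by (simp add: norm_mult norm_xpow power_mult_distrib norm_power)
    qed
    also have "(x powr Re s)\<^sup>2 = x powr (2 * Re s)" by (simp add: power2_eq_square powr_add[symmetric])
    also have "(ln x)^(2*k) * x powr (2 * Re s) = Re (of_real (ln x ^ (2 * k)) * of_real (x powr (2 * Re s)))"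
      by simp
    also have "complex_of_real (x powr (2 * Re s)) = xpow (of_real (2 * Re s)) x"
      using powr_of_real[OF x, of "2 * Re s"] by (simp add: xpow_def)
    finally show "Re (of_real (ln x ^ (2 * k)) * xpow (of_real (2 * Re s)) x) = (norm (of_real (ln x ^ k) * xpow s x))\<^sup>2"
      by simp
  qed
  moreover have "(\<lambda>x. of_real (ln x ^ k) * xpow s x) \<in> borel_measurable I01"
    using integrable_ln_xpow[of s k] assms by (intro borel_measurable_integrable) (simp add: half_plane_def)
  ultimately show ?thesis by (simp add: L2_def)
qed

lemma L2_xpow: "s \<in> half_plane \<Longrightarrow> xpow s \<in> L2"
  using L2_ln_xpow[of s 0] by simp

lemma L2_inner_xpow:
  assumes "f \<in> L2"
  shows "L2_inner f (xpow (cnj s)) = (LINT x|I01. f x * xpow s x)"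
  unfolding L2_inner_def by (rule Bochner_Integration.integral_cong) (simp_all add: cnj_xpow)

lemma L2_norm_xpow:
  assumes "s \<in> half_plane"
  shows "(L2_norm (xpow s))\<^sup>2 = 1 / (1 + 2 * Re s)"
proof -
  have "of_real ((L2_norm (xpow s))\<^sup>2) = L2_inner (xpow s) (xpow (cnj (cnj s)))"
    by (simp add: L2_inner_self)
  also have "\<dots> = 1 / (1 + (s + cnj s))"
    unfolding L2_inner_xpow[OF L2_xpow[OF assms]] xpow_add
    using assms by (subst integral_xpow) (auto simp: half_plane_def)
  also have "\<dots> = of_real (1 / (1 + 2 * Re s))" by (simp add: complex_add_cnj)
  finally show ?thesis using of_real_eq_iff by blast
qed

section \<open>Laguerre functions\<close>

text \<open>
  In terms of the classical Laguerre polynomials this is \<open>L\<^sub>n(- ln x)\<close>. The factor \<open>xpow 0\<close> is 1 except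
  at \<open>x = 0\<close>, where it gives all these functions the value 0 that the powers have there.
\<close>

definition laguerre :: "nat \<Rightarrow> real \<Rightarrow> complex" where
  "laguerre n x = (\<Sum>k\<le>n. of_nat (n choose k) / fact k * (of_real (ln x ^ k) * xpow 0 x))"

lemma L2_laguerre: "laguerre n \<in> L2"
  unfolding laguerre_def by (intro L2_sum L2_cmult L2_ln_xpow) simp

lemma cnj_laguerre: "0 \<le> x \<Longrightarrow> cnj (laguerre n x) = laguerre n x"
  by (simp add: laguerre_def cnj_xpow)

text \<open>
  With \<open>w = 1 / (1 + s)\<close> the integral is \<open>w\<close> times the binomial expansion of \<open>(1 - w)\<^sup>n\<close>, and
  \<open>1 - w = \<lambda>(s)\<close>. Thus \<open>U\<close> maps these functions to the powers of \<open>\<lambda>\<close>.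
\<close>

lemma integral_laguerre_xpow:
  assumes "s \<in> half_plane"
  shows "(LINT x|I01. laguerre n x * xpow s x) = lam s ^ n / (1 + s)"
proof -
  have nz: "1 + s \<noteq> 0" by (rule half_plane_1) fact
  have s: "-1 < Re s" using assms by (simp add: half_plane_def)
  have "(LINT x|I01. laguerre n x * xpow s x) = 
     (LINT x|I01. (\<Sum>k\<le>n. of_nat (n choose k) / fact k * (of_real (ln x ^ k) * xpow s x)))"
    by (rule Bochner_Integration.integral_cong[OF refl], unfold laguerre_def sum_distrib_right)
       (simp add: mult.assoc xpow_add)
  also have "\<dots> = (\<Sum>k\<le>n. of_nat (n choose k) / fact k * ((-1) ^ k * fact k / (1 + s) ^ Suc k))"
    using integrable_ln_xpow[OF s] by (subst Bochner_Integration.integral_sum) (auto simp: integral_ln_xpow[OF s] simp del: of_real_power)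
  also have "\<dots> = (\<Sum>k\<le>n. of_nat (n choose k) * (- 1 / (1 + s)) ^ k * 1 ^ (n - k)) / (1 + s)"
    unfolding sum_divide_distrib by (rule sum.cong) (simp_all add: power_minus' power_divide)
  also have "\<dots> = (- 1 / (1 + s) + 1) ^ n / (1 + s)"
    by (simp only: binomial_ring[symmetric])
  also have "- 1 / (1 + s) + 1 = lam s"
    using nz by (simp add: lam_def field_simps)
  finally show ?thesis .
qed

text \<open>
  Since \<open>(j + k) choose j\<close> is up to the sign \<open>(-1)\<^sup>j\<close> the generalised binomial coefficient
  \<open>(- k - 1) gchoose j\<close>, this is a Vandermonde convolution with the value \<open>(n - k - 1) gchoose n\<close>.
\<close>

lemma alternating_binomial_sum:
  assumes "k \<le> n"
  shows "(\<Sum>j\<le>n. (-1) ^ j * of_nat (n choose j) * of_nat ((j + k) choose j)) = (if k = n then (-1) ^ n else (0::complex))"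
proof -
  have "(\<Sum>j\<le>n. (-1) ^ j * of_nat (n choose j) * of_nat ((j + k) choose j)) =
     (\<Sum>j\<in>{0..n}. ((- of_nat (Suc k)) gchoose j) * ((of_nat n :: complex) gchoose (n - j)))"
  proof (rule sum.cong)
    fix j assume j: "j \<in> {0..n}"
    have "((- of_nat (Suc k)) gchoose j) = (-1) ^ j * ((of_nat (j + k)) gchoose j :: complex)"
      by (subst gbinomial_negated_upper) (simp add: algebra_simps)
    moreover have "((of_nat n :: complex) gchoose (n - j)) = of_nat (n choose j)"
      using j by (simp add: binomial_gbinomial[symmetric] binomial_symmetric[symmetric])
    ultimately show "(-1) ^ j * of_nat (n choose j) * of_nat ((j + k) choose j) =
       ((- of_nat (Suc k)) gchoose j) * ((of_nat n :: complex) gchoose (n - j))"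
      by (simp only: binomial_gbinomial mult_ac)
  qed auto
  also have "\<dots> = (- of_nat (Suc k) + of_nat n) gchoose n"
    by (rule gbinomial_Vandermonde)
  also have "\<dots> = (if k = n then (-1) ^ n else 0)"
  proof (cases "k = n")
    case True
    then show ?thesis using gbinomial_negated_upper[of "-1::complex" n] by (simp add: binomial_gbinomial[symmetric])
  next
    case False
    with assms have "k < n" by simp
    then have "(- of_nat (Suc k) + of_nat n :: complex) = of_nat (n - Suc k)" by (simp add: of_nat_diff)
    then show ?thesis using \<open>k < n\<close> by (simp add: binomial_gbinomial[symmetric] del: of_nat_diff)
  qed
  finally show ?thesis .
qed

lemma laguerre_orthonormal: "L2_inner (laguerre n) (laguerre m) = (if n = m then 1 else 0)"
proof -
  have *: "L2_inner (laguerre n) (laguerre m) = (if n = m then 1 else 0)" if "m \<le> n" for n m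
  proof -
    have "L2_inner (laguerre n) (laguerre m) = (LINT x|I01. laguerre m x * laguerre n x)"
      unfolding L2_inner_def by (rule Bochner_Integration.integral_cong) (simp_all add: cnj_laguerre mult.commute)
    also have "\<dots> = (LINT x|I01. (\<Sum>k\<le>m. \<Sum>j\<le>n. of_nat (m choose k) / fact k * (of_nat (n choose j) / fact j)
        * (of_real (ln x ^ (k + j)) * xpow 0 x)))"
    proof (rule Bochner_Integration.integral_cong[OF refl])
      fix x
      have "xpow 0 x * xpow 0 x = xpow 0 x" by (simp add: xpow_add)
      then show "laguerre m x * laguerre n x = (\<Sum>k\<le>m. \<Sum>j\<le>n. of_nat (m choose k) / fact k * (of_nat (n choose j) / fact j)
        * (of_real (ln x ^ (k + j)) * xpow 0 x))"
        unfolding laguerre_def sum_product by (intro sum.cong refl) (auto simp: power_add)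
    qed
    also have "\<dots> = (\<Sum>k\<le>m. \<Sum>j\<le>n. of_nat (m choose k) / fact k * (of_nat (n choose j) / fact j) * ((-1) ^ (k + j) * fact (k + j)))"
    proof -
      have i: "integrable I01 (\<lambda>x. of_real (ln x ^ k) * xpow 0 x)" for k
        by (rule integrable_ln_xpow) simp
      show ?thesis
        by (subst Bochner_Integration.integral_sum, intro Bochner_Integration.integrable_sum integrable_mult_right i)
           (subst Bochner_Integration.integral_sum, (intro integrable_mult_right i),
             simp add: integral_ln_xpow[where s = 0] del: of_real_power)
    qed
    also have "\<dots> = (\<Sum>k\<le>m. (-1) ^ k * of_nat (m choose k) * (\<Sum>j\<le>n. (-1) ^ j * of_nat (n choose j) * of_nat ((j + k) choose j)))"
      unfolding sum_distrib_left
      by (intro sum.cong refl) (simp add: binomial_fact field_simps power_add)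
    also have "\<dots> = (\<Sum>k\<le>m. if k = n then (-1) ^ k * of_nat (m choose k) * (-1) ^ n else 0)"
      using that by (intro sum.cong refl) (simp add: alternating_binomial_sum)
    also have "\<dots> = (if n = m then 1 else 0)"
      using that by (auto simp: power_add[symmetric])
    finally show ?thesis .
  qed
  show ?thesis
  proof (cases "m \<le> n")
    case False
    then show ?thesis using *[of n m] by (subst L2_inner_commute) simp
  qed (rule *)
qed

section \<open>Moments determine an \<open>L\<^sup>2\<close> function\<close>

lemma complex_polynomial_approximation:
  fixes f :: "real \<Rightarrow> complex"
  assumes "continuous_on {0..1} f" "0 < e"
  obtains c :: "nat \<Rightarrow> complex" and n where "\<And>x. x \<in> {0..1} \<Longrightarrow> norm (f x - (\<Sum>i\<le>n. c i * of_real (x ^ i))) < e"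
proof -
  obtain g where g: "polynomial_function g" "\<And>x. x \<in> {0..1} \<Longrightarrow> norm (f x - g x) < e"
    using Stone_Weierstrass_polynomial_function[of "{0..1}" f e] assms by (auto simp: compact_Icc)
  have "real_polynomial_function (Re \<circ> g)" "real_polynomial_function (Im \<circ> g)"
    using g(1) bounded_linear_Re bounded_linear_Im unfolding polynomial_function_def by blast+
  then obtain a n b m where a: "Re \<circ> g = (\<lambda>x. \<Sum>i\<le>n. a i * x ^ i)" and b: "Im \<circ> g = (\<lambda>x. \<Sum>i\<le>m. b i * x ^ i)"
    unfolding real_polynomial_function_iff_sum by blast
  define c where "c i = Complex (if i \<le> n then a i else 0) (if i \<le> m then b i else 0)" for i
  have "g x = (\<Sum>i\<le>max n m. c i * of_real (x ^ i))" for x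
  proof (rule complex_eqI)
    have "Re (g x) = (\<Sum>i\<le>n. a i * x ^ i)" using fun_cong[OF a, of x] by simp
    also have "\<dots> = (\<Sum>i\<le>max n m. (if i \<le> n then a i else 0) * x ^ i)"
      by (rule sum.mono_neutral_cong_left) auto
    finally show "Re (g x) = Re (\<Sum>i\<le>max n m. c i * of_real (x ^ i))" by (simp add: c_def del: of_real_power)
    have "Im (g x) = (\<Sum>i\<le>m. b i * x ^ i)" using fun_cong[OF b, of x] by simp
    also have "\<dots> = (\<Sum>i\<le>max n m. (if i \<le> m then b i else 0) * x ^ i)"
      by (rule sum.mono_neutral_cong_left) auto
    finally show "Im (g x) = Im (\<Sum>i\<le>max n m. c i * of_real (x ^ i))" by (simp add: c_def del: of_real_power)
  qed
  with g(2) that show ?thesis by metis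
qed

text \<open>
  Weierstrass approximation with \<open>xpow (of_nat i)\<close> in place of the monomials: the two differ at
  \<open>x = 0\<close> when \<open>i = 0\<close>, which is why that point is left out.
\<close>

lemma xpow_approximation:
  fixes f :: "real \<Rightarrow> complex"
  assumes "continuous_on {0..1} f" "0 < e"
  obtains c :: "nat \<Rightarrow> complex" and n where
    "\<And>x. x \<in> {0<..1} \<Longrightarrow> norm (f x - (\<Sum>i\<le>n. c i * xpow (of_nat i) x)) < e"
proof -
  obtain c :: "nat \<Rightarrow> complex" and n where c: "\<And>x. x \<in> {0..1} \<Longrightarrow> norm (f x - (\<Sum>i\<le>n. c i * of_real (x ^ i))) < e"
    using complex_polynomial_approximation[OF assms] by blast
  have "norm (f x - (\<Sum>i\<le>n. c i * xpow (of_nat i) x)) < e" if "x \<in> {0<..1}" for x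
    using c[of x] that by (simp add: xpow_of_nat del: of_real_power)
  then show ?thesis by (rule that)
qed

lemma AE_I01_pos: "AE x in I01. 0 < x"
proof -
  have "{0::real} \<in> null_sets lebesgue" by simp
  then have "AE x in lebesgue. x \<noteq> (0::real)" by (drule_tac AE_not_in) simp
  then show ?thesis by (simp add: AE_restrict_space_iff) (auto elim: eventually_mono)
qed

lemma integral_mult_norm_bound:
  fixes f p :: "real \<Rightarrow> complex"
  assumes f: "integrable I01 f" and fp: "integrable I01 (\<lambda>x. f x * p x)"
    and p: "\<And>x. x \<in> {0<..1} \<Longrightarrow> norm (p x) \<le> e"
  shows "norm (LINT x|I01. f x * p x) \<le> e * (LINT x|I01. norm (f x))"
proof -
  have "norm (LINT x|I01. f x * p x) \<le> (LINT x|I01. norm (f x * p x))"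
    by (rule integral_norm_bound)
  also have "\<dots> \<le> (LINT x|I01. e * norm (f x))"
  proof (rule integral_mono_AE)
    show "AE x in I01. norm (f x * p x) \<le> e * norm (f x)"
      using AE_I01_pos AE_space
    proof eventually_elim
      case (elim x)
      then have "norm (f x) * norm (p x) \<le> norm (f x) * e" by (intro mult_left_mono p) auto
      then show ?case by (simp add: norm_mult mult.commute)
    qed
  qed (use f fp in auto)
  finally show ?thesis by simp
qed

lemma integral_continuous_zero_if_moments_zero:
  assumes f: "f \<in> L2" and 0: "\<And>n. (LINT x|I01. f x * xpow (of_nat n) x) = 0"
    and \<phi>: "continuous_on {0..1} \<phi>"
  shows "(LINT x|I01. f x * \<phi> x) = 0"
proof -
  have m\<phi>: "\<phi> \<in> borel_measurable I01" using \<phi> by (rule continuous_imp_measurable_on_sets_lebesgue) simp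
  have bounded: "\<exists>B. \<forall>x\<in>{0..1}. norm (\<phi> x) \<le> B"
    using compact_imp_bounded[OF compact_continuous_image[OF \<phi> compact_Icc]] by (auto simp: bounded_iff)
  then obtain B where B: "\<And>x. x \<in> {0..1} \<Longrightarrow> norm (\<phi> x) \<le> B" by blast
  have if\<phi>: "integrable I01 (\<lambda>x. f x * \<phi> x)"
  proof (rule Bochner_Integration.integrable_bound)
    show "integrable I01 (\<lambda>x. of_real B * f x)" using L2_integrable[OF f] by simp
    show "AE x in I01. norm (f x * \<phi> x) \<le> norm (of_real B * f x)"
    proof (rule AE_I2)
      fix x assume "x \<in> space I01"
      then have "norm (\<phi> x) \<le> \<bar>B\<bar>" using B[of x] by simp
      then have "norm (f x) * norm (\<phi> x) \<le> norm (f x) * \<bar>B\<bar>" by (rule mult_left_mono) simp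
      then show "norm (f x * \<phi> x) \<le> norm (of_real B * f x)" by (simp add: norm_mult mult.commute)
    qed
  qed (use m\<phi> L2_measurable[OF f] in measurable)
  define I where "I = (LINT x|I01. norm (f x))"
  have I0: "0 \<le> I" unfolding I_def by (rule integral_nonneg_AE) simp
  have "norm (LINT x|I01. f x * \<phi> x) \<le> e" if "0 < e" for e
  proof -
    have e': "0 < e / (I + 1)" using that I0 by simp
    obtain c :: "nat \<Rightarrow> complex" and n where c: "\<And>x. x \<in> {0<..1} \<Longrightarrow> norm (\<phi> x - (\<Sum>i\<le>n. c i * xpow (of_nat i) x)) < e / (I + 1)"
      using xpow_approximation[OF \<phi> e'] by blast
    have ip: "integrable I01 (\<lambda>x. c i * (f x * xpow (of_nat i) x))" for i
      by (intro integrable_mult_right L2_integrable_mult f L2_xpow) simp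
    have "(LINT x|I01. (\<Sum>i\<le>n. c i * (f x * xpow (of_nat i) x))) = 0"
      using ip by (subst Bochner_Integration.integral_sum) (auto simp: 0)
    then have eq: "(LINT x|I01. f x * \<phi> x) = (LINT x|I01. f x * \<phi> x - (\<Sum>i\<le>n. c i * (f x * xpow (of_nat i) x)))"
      using Bochner_Integration.integral_diff[OF if\<phi> Bochner_Integration.integrable_sum[OF ip], of "\<lambda>i. i" "{..n}"] by simp
    have factor: "f x * \<phi> x - (\<Sum>i\<le>n. c i * (f x * xpow (of_nat i) x)) = f x * (\<phi> x - (\<Sum>i\<le>n. c i * xpow (of_nat i) x))" for x
      by (simp add: right_diff_distrib sum_distrib_left mult_ac)
    have "norm (LINT x|I01. f x * \<phi> x) \<le> e / (I + 1) * (LINT x|I01. norm (f x))"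
      unfolding eq factor
    proof (rule integral_mult_norm_bound[OF L2_integrable[OF f]])
      show "integrable I01 (\<lambda>x. f x * (\<phi> x - (\<Sum>i\<le>n. c i * xpow (of_nat i) x)))"
        unfolding factor[symmetric] using if\<phi> ip
        by (intro Bochner_Integration.integrable_diff Bochner_Integration.integrable_sum)
    qed (use c in \<open>auto intro: less_imp_le\<close>)
    also have "\<dots> = e / (I + 1) * I" by (simp add: I_def)
    also have "\<dots> \<le> e" using I0 that by (simp add: field_simps)
    finally show ?thesis .
  qed
  then show ?thesis using field_le_epsilon[of "norm (LINT x|I01. f x * \<phi> x)" 0] by simp
qed

text \<open>
  The indicator of a measurable set is an almost everywhere limit of continuous functions, which may
  be clipped to \<open>[0,1]\<close>; by dominated convergence the integral of \<open>f\<close> over every measurable set is zero.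
\<close>

lemma L2_zero_if_moments_zero:
  assumes f: "f \<in> L2" and 0: "\<And>n. (LINT x|I01. f x * xpow (of_nat n) x) = 0"
  shows "f \<doteq> (\<lambda>x. 0)"
  unfolding L2_eq_def
proof (rule sigma_finite_measure.density_zero)
  show "sigma_finite_measure I01" using finite_measure_I01 by (simp add: finite_measure_def)
  show i: "integrable I01 f" by (rule L2_integrable[OF f])
  fix A assume A: "A \<in> sets I01"
  have "(indicator A :: real \<Rightarrow> real) measurable_on {0..1}"
    using A by (subst measurable_on_iff_borel_measurable) auto
  then obtain N and g :: "nat \<Rightarrow> real \<Rightarrow> real" where N: "negligible N" and g: "\<And>n. continuous_on UNIV (g n)"
    and lim: "\<And>x. x \<notin> N \<Longrightarrow> (\<lambda>n. g n x) \<longlonglongrightarrow> (if x \<in> {0..1} then indicator A x else 0)"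
    unfolding measurable_on_def by blast
  define h where "h n x = max 0 (min 1 (g n x))" for n x
  have ch: "continuous_on {0..1} (\<lambda>x. complex_of_real (h n x))" for n
    unfolding h_def by (intro continuous_intros continuous_on_subset[OF g]) auto
  have "(\<lambda>n. LINT x|I01. f x * of_real (h n x)) \<longlonglongrightarrow> (LINT x|I01. f x * of_real (indicator A x))"
  proof (rule integral_dominated_convergence[where w = "\<lambda>x. norm (f x)"])
    show "AE x in I01. (\<lambda>n. f x * of_real (h n x)) \<longlonglongrightarrow> f x * of_real (indicator A x)"
    proof -
      have "AE x in lebesgue. x \<notin> N" using N by (simp add: negligible_iff_null_sets AE_not_in)
      then have "AE x in I01. x \<notin> N" by (simp add: AE_restrict_space_iff) (auto elim: eventually_mono)
      then show ?thesis using AE_space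
      proof eventually_elim
        case (elim x)
        then have "(\<lambda>n. g n x) \<longlonglongrightarrow> indicator A x" using lim[of x] by simp
        then have "(\<lambda>n. h n x) \<longlonglongrightarrow> max 0 (min 1 (indicator A x))"
          unfolding h_def by (intro tendsto_intros)
        also have "max 0 (min 1 (indicator A x)) = (indicator A x :: real)" by (simp add: indicator_def)
        finally show ?case by (intro tendsto_intros)
      qed
    qed
    show "AE x in I01. norm (f x * of_real (h n x)) \<le> norm (f x)" for n
      by (intro AE_I2) (auto simp: norm_mult h_def intro!: mult_left_le)
    show "(\<lambda>x. f x * complex_of_real (indicat_real A x)) \<in> borel_measurable I01"
      using A L2_measurable[OF f] by measurable
    show "(\<lambda>x. f x * complex_of_real (h n x)) \<in> borel_measurable I01" for n
    proof -
      have "(\<lambda>x. complex_of_real (h n x)) \<in> borel_measurable I01"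
        by (rule continuous_imp_measurable_on_sets_lebesgue[OF ch]) simp
      then show ?thesis using L2_measurable[OF f] by measurable
    qed
  qed (use i in simp)
  moreover have "(LINT x|I01. f x * of_real (h n x)) = 0" for n
    by (rule integral_continuous_zero_if_moments_zero[OF f 0 ch])
  ultimately have "(LINT x|I01. f x * of_real (indicator A x)) = 0"
    by (simp add: LIMSEQ_const_iff)
  then show "set_lebesgue_integral I01 A f = 0"
    by (simp add: set_lebesgue_integral_def scaleR_conv_of_real mult.commute)
qed

lemma L2_eqI_moments:
  assumes "f \<in> L2" "g \<in> L2"
    and "\<And>n. (LINT x|I01. f x * xpow (of_nat n) x) = (LINT x|I01. g x * xpow (of_nat n) x)"
  shows "f \<doteq> g"
proof -
  have "(\<lambda>x. f x - g x) \<doteq> (\<lambda>x. 0)"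
    using assms by (intro L2_zero_if_moments_zero L2_diff)
      (simp_all add: left_diff_distrib L2_integrable_mult L2_xpow)
  then show ?thesis by (simp add: L2_eq_def)
qed

section \<open>The Laguerre basis\<close>

definition laguerre_coeff :: "(real \<Rightarrow> complex) \<Rightarrow> nat \<Rightarrow> complex" where
  "laguerre_coeff f n = L2_inner f (laguerre n)"

definition laguerre_sum :: "(nat \<Rightarrow> complex) \<Rightarrow> nat set \<Rightarrow> real \<Rightarrow> complex" where
  "laguerre_sum a A x = (\<Sum>n\<in>A. a n * laguerre n x)"

lemma L2_laguerre_sum: "laguerre_sum a A \<in> L2"
  unfolding laguerre_sum_def by (intro L2_sum L2_cmult L2_laguerre)

lemma L2_inner_laguerre_sum:
  assumes "f \<in> L2"
  shows "L2_inner (laguerre_sum a A) f = (\<Sum>n\<in>A. a n * cnj (laguerre_coeff f n))"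
proof -
  have "L2_inner (laguerre_sum a A) f = (\<Sum>n\<in>A. L2_inner (\<lambda>x. a n * laguerre n x) f)"
    unfolding laguerre_sum_def by (rule L2_inner_sum_left) (auto intro: L2_cmult L2_laguerre assms)
  then show ?thesis
    by (simp add: L2_inner_cmult_left laguerre_coeff_def L2_inner_commute[of f])
qed

lemma laguerre_coeff_sum:
  assumes "finite A"
  shows "laguerre_coeff (laguerre_sum a A) n = (if n \<in> A then a n else 0)"
proof -
  have "laguerre_coeff (laguerre_sum a A) n = (\<Sum>m\<in>A. a m * cnj (L2_inner (laguerre n) (laguerre m)))"
    unfolding laguerre_coeff_def[of "laguerre_sum a A"]
    by (subst L2_inner_laguerre_sum) (simp_all add: L2_laguerre laguerre_coeff_def)
  also have "\<dots> = (\<Sum>m\<in>A. if m = n then a m else 0)"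
    by (intro sum.cong) (auto simp: laguerre_orthonormal)
  finally show ?thesis using assms by simp
qed

lemma L2_norm_laguerre_sum:
  assumes "finite A"
  shows "(L2_norm (laguerre_sum a A))\<^sup>2 = (\<Sum>n\<in>A. (norm (a n))\<^sup>2)"
proof -
  have "complex_of_real ((L2_norm (laguerre_sum a A))\<^sup>2) = (\<Sum>n\<in>A. a n * cnj (a n))"
    using assms by (simp add: L2_inner_self[symmetric] L2_inner_laguerre_sum L2_laguerre_sum laguerre_coeff_sum del: of_real_power)
  also have "\<dots> = of_real (\<Sum>n\<in>A. (norm (a n))\<^sup>2)"
    by (simp add: complex_norm_square[symmetric])
  finally show ?thesis using of_real_eq_iff by blast
qed

lemma L2_norm_diff_laguerre_sum:
  assumes "f \<in> L2" "finite A"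
  shows "(L2_norm (\<lambda>x. f x - laguerre_sum (laguerre_coeff f) A x))\<^sup>2 = (L2_norm f)\<^sup>2 - (\<Sum>n\<in>A. (norm (laguerre_coeff f n))\<^sup>2)"
proof -
  let ?S = "laguerre_sum (laguerre_coeff f) A"
  note L = assms(1) L2_laguerre_sum
  have S: "L2_inner ?S f = of_real (\<Sum>n\<in>A. (norm (laguerre_coeff f n))\<^sup>2)"
    using assms by (simp add: L2_inner_laguerre_sum complex_norm_square[symmetric])
  have "of_real ((L2_norm (\<lambda>x. f x - ?S x))\<^sup>2) = L2_inner (\<lambda>x. f x - ?S x) (\<lambda>x. f x - ?S x)"
    by (simp only: L2_inner_self)
  also have "\<dots> = L2_inner f f - L2_inner f ?S - (L2_inner ?S f - L2_inner ?S ?S)"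
    using L by (simp add: L2_inner_diff_left L2_inner_diff_right L2_diff)
  also have "L2_inner f ?S = cnj (L2_inner ?S f)" by (rule L2_inner_commute)
  also have "L2_inner ?S ?S = of_real (\<Sum>n\<in>A. (norm (laguerre_coeff f n))\<^sup>2)"
    using assms by (simp add: L2_inner_self L2_norm_laguerre_sum del: of_real_power)
  also have "L2_inner f f - cnj (L2_inner ?S f) - (L2_inner ?S f - of_real (\<Sum>n\<in>A. (norm (laguerre_coeff f n))\<^sup>2)) =
    of_real ((L2_norm f)\<^sup>2 - (\<Sum>n\<in>A. (norm (laguerre_coeff f n))\<^sup>2))"
    unfolding S by (simp add: L2_inner_self)
  finally show ?thesis using of_real_eq_iff by blast
qed

lemma laguerre_Bessel:
  assumes "f \<in> L2"
  shows "summable (\<lambda>n. (norm (laguerre_coeff f n))\<^sup>2)"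
proof (rule bounded_imp_summable)
  fix n
  have "(\<Sum>k\<in>{..n}. (norm (laguerre_coeff f k))\<^sup>2) \<le> (L2_norm f)\<^sup>2"
    using L2_norm_diff_laguerre_sum[OF assms, of "{..n}"]
      zero_le_power2[of "L2_norm (\<lambda>x. f x - laguerre_sum (laguerre_coeff f) {..n} x)"] by simp
  then show "(\<Sum>k\<le>n. (norm (laguerre_coeff f k))\<^sup>2) \<le> (L2_norm f)\<^sup>2" .
qed simp

lemma laguerre_coeff_xpow:
  assumes "s \<in> half_plane"
  shows "laguerre_coeff (xpow s) n = lam s ^ n / (1 + s)"
proof -
  have "laguerre_coeff (xpow s) n = (LINT x|I01. laguerre n x * xpow s x)"
    unfolding laguerre_coeff_def L2_inner_def
    by (rule Bochner_Integration.integral_cong) (simp_all add: cnj_laguerre mult.commute)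
  then show ?thesis using integral_laguerre_xpow[OF assms] by simp
qed

lemma norm_lam: "s \<in> half_plane \<Longrightarrow> norm (lam s) < 1"
  using bij_betw_apply[OF bij_betw_lam, of s] by simp

text \<open>
  For \<open>x\<^sup>s\<close> Bessel's inequality is an equality: the squared coefficients form a geometric series.
  So \<open>x\<^sup>s\<close> lies in the closed span of the Laguerre functions, from which completeness follows.
\<close>

lemma laguerre_Parseval_xpow:
  assumes "s \<in> half_plane"
  shows "(\<lambda>n. (norm (laguerre_coeff (xpow s) n))\<^sup>2) sums (L2_norm (xpow s))\<^sup>2"
proof -
  have nz: "1 + s \<noteq> 0" by (rule half_plane_1) fact
  have l: "(norm (lam s))\<^sup>2 < 1" using norm_lam[OF assms] by (simp add: power_less_one_iff abs_square_less_1)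
  have "(\<lambda>n. 1 / (norm (1 + s))\<^sup>2 * ((norm (lam s))\<^sup>2) ^ n) sums (1 / (norm (1 + s))\<^sup>2 * (1 / (1 - (norm (lam s))\<^sup>2)))"
    by (rule sums_mult geometric_sums)+ (use l in simp)
  also have "(\<lambda>n. 1 / (norm (1 + s))\<^sup>2 * ((norm (lam s))\<^sup>2) ^ n) = (\<lambda>n. (norm (laguerre_coeff (xpow s) n))\<^sup>2)"
    by (simp add: laguerre_coeff_xpow[OF assms] norm_divide norm_power power_divide power_mult[symmetric] mult.commute)
  also have "1 / (norm (1 + s))\<^sup>2 * (1 / (1 - (norm (lam s))\<^sup>2)) = (L2_norm (xpow s))\<^sup>2"
  proof -
    have "(norm (1 + s))\<^sup>2 * (1 - (norm (lam s))\<^sup>2) = (norm (1 + s))\<^sup>2 - (norm s)\<^sup>2"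
      using nz by (simp add: lam_def norm_divide power_divide right_diff_distrib add.commute)
    also have "\<dots> = 1 + 2 * Re s" unfolding cmod_power2 by (simp add: power2_eq_square algebra_simps)
    finally show ?thesis using L2_norm_xpow[OF assms] by (simp add: mult.commute)
  qed
  finally show ?thesis .
qed

text \<open>
  A function orthogonal to all Laguerre functions is orthogonal to their closed span, hence to all
  monomials.
\<close>

lemma laguerre_complete:
  assumes f: "f \<in> L2" and 0: "\<And>n. laguerre_coeff f n = 0"
  shows "f \<doteq> (\<lambda>x. 0)"
proof (rule L2_zero_if_moments_zero[OF f])
  fix n
  let ?g = "xpow (of_nat n)"
  have g: "?g \<in> L2" by (rule L2_xpow) simp
  let ?S = "\<lambda>N. laguerre_sum (laguerre_coeff ?g) {..<N}"
  have "(\<lambda>N. (L2_norm (\<lambda>x. ?g x - ?S N x))\<^sup>2) \<longlonglongrightarrow> (L2_norm ?g)\<^sup>2 - (L2_norm ?g)\<^sup>2"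
    unfolding L2_norm_diff_laguerre_sum[OF g finite_lessThan]
    using laguerre_Parseval_xpow[of "of_nat n"] by (intro tendsto_intros) (simp add: sums_def)
  then have lim: "(\<lambda>N. L2_norm f * L2_norm (\<lambda>x. ?g x - ?S N x)) \<longlonglongrightarrow> 0"
    by (intro tendsto_mult_right_zero, drule_tac tendsto_real_sqrt) (simp add: L2_norm_nonneg)
  have "norm (L2_inner f ?g) \<le> L2_norm f * L2_norm (\<lambda>x. ?g x - ?S N x)" for N
  proof -
    have "L2_inner f (?S N) = cnj (L2_inner (?S N) f)" by (rule L2_inner_commute)
    also have "\<dots> = 0" using f 0 by (simp add: L2_inner_laguerre_sum)
    finally have "L2_inner f ?g = L2_inner f (\<lambda>x. ?g x - ?S N x)"
      using f g L2_laguerre_sum by (simp add: L2_inner_diff_right)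
    then show ?thesis using L2_Cauchy_Schwarz[OF f L2_diff[OF g L2_laguerre_sum]] by simp
  qed
  then have "norm (L2_inner f ?g) \<le> 0"
    using LIMSEQ_le_const[OF lim] by blast
  then show "(LINT x|I01. f x * ?g x) = 0"
    using L2_inner_xpow[OF f, of "of_nat n"] by simp
qed

lemma laguerre_sum_split:
  assumes "M \<le> N"
  shows "laguerre_sum a {..<N} x = laguerre_sum a {..<M} x + laguerre_sum a {M..<N} x"
proof -
  have "{..<N} = {..<M} \<union> {M..<N}" using assms by auto
  moreover have "(\<Sum>n\<in>{..<M} \<union> {M..<N}. a n * laguerre n x) = (\<Sum>n<M. a n * laguerre n x) + (\<Sum>n=M..<N. a n * laguerre n x)"
    by (rule sum.union_disjoint) auto
  ultimately show ?thesis unfolding laguerre_sum_def by simp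
qed

text \<open>
  Integrate \<open>2 e \<bar>f\<bar> \<le> \<bar>f\<bar>\<^sup>2 + e\<^sup>2\<close>; the interval has measure 1.
\<close>

lemma L2_norm1_bound:
  assumes f: "f \<in> L2" and n: "(L2_norm f)\<^sup>2 \<le> e\<^sup>2" and e: "0 < e"
  shows "(LINT x|I01. norm (f x)) \<le> e"
proof -
  have "(LINT x|I01. norm (f x)) \<le> (LINT x|I01. (norm (f x))\<^sup>2 / (2 * e) + e / 2)"
  proof (rule integral_mono_AE)
    show "integrable I01 (\<lambda>x. norm (f x))" using L2_integrable[OF f] by simp
    show "integrable I01 (\<lambda>x. (norm (f x))\<^sup>2 / (2 * e) + e / 2)"
      by (intro Bochner_Integration.integrable_add finite_measure.integrable_const[OF finite_measure_I01])
         (simp add: L2_integrable_sq[OF f])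
    show "AE x in I01. norm (f x) \<le> (norm (f x))\<^sup>2 / (2 * e) + e / 2"
    proof (rule AE_I2)
      fix x
      have "0 \<le> (norm (f x) - e)\<^sup>2" by simp
      then have "2 * e * norm (f x) \<le> (norm (f x))\<^sup>2 + e\<^sup>2" by (simp add: power2_diff mult_ac)
      then show "norm (f x) \<le> (norm (f x))\<^sup>2 / (2 * e) + e / 2"
        using e by (simp add: field_simps power2_eq_square)
    qed
  qed
  also have "\<dots> = (L2_norm f)\<^sup>2 / (2 * e) + e / 2"
    using L2_integrable_sq[OF f] by (simp add: L2_norm_sq finite_measure.integrable_const[OF finite_measure_I01] measure_restrict_space)
  also have "\<dots> \<le> e\<^sup>2 / (2 * e) + e / 2"
    using n e by (intro add_right_mono divide_right_mono) auto
  also have "\<dots> = e" using e by (simp add: field_simps power2_eq_square)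
  finally show ?thesis .
qed

lemma AE_summable_of_integral_norm:
  fixes d :: "nat \<Rightarrow> 'a \<Rightarrow> complex"
  assumes i: "\<And>k. integrable M (d k)" and b: "\<And>k. (LINT x|M. norm (d k x)) \<le> r k"
    and r: "summable r"
  shows "AE x in M. summable (\<lambda>k. d k x)"
proof -
  have r0: "0 \<le> r k" for k by (rule order_trans[OF integral_nonneg_AE b]) simp
  have [measurable]: "d k \<in> borel_measurable M" for k using i by (rule borel_measurable_integrable)
  have "(\<integral>\<^sup>+x. (\<Sum>k. ennreal (norm (d k x))) \<partial>M) = (\<Sum>k. \<integral>\<^sup>+x. ennreal (norm (d k x)) \<partial>M)"
    by (rule nn_integral_suminf) measurable
  also have "\<dots> \<le> (\<Sum>k. ennreal (r k))"
    using i b by (intro suminf_le) (auto simp: nn_integral_eq_integral intro: ennreal_leI)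
  also have "\<dots> = ennreal (suminf r)" by (rule suminf_ennreal2) (use r r0 in auto)
  finally have "(\<integral>\<^sup>+x. (\<Sum>k. ennreal (norm (d k x))) \<partial>M) \<le> ennreal (suminf r)" .
  from neq_top_trans[OF ennreal_neq_top this]
  have "(\<integral>\<^sup>+x. (\<Sum>k. ennreal (norm (d k x))) \<partial>M) \<noteq> \<infinity>"
    unfolding infinity_ennreal_def .
  then have "AE x in M. (\<Sum>k. ennreal (norm (d k x))) \<noteq> \<infinity>"
    by (rule nn_integral_PInf_AE[rotated]) measurable
  then show ?thesis
  proof eventually_elim
    case (elim x)
    then have "summable (\<lambda>k. norm (d k x))" by (intro summable_suminf_not_top) simp_all
    then show ?case by (rule summable_norm_cancel)
  qed
qed

lemma L2_Fatou:
  assumes g: "\<And>k. g k \<in> L2" and h: "h \<in> borel_measurable I01"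
    and lim: "AE x in I01. (\<lambda>k. g k x) \<longlonglongrightarrow> h x"
    and b: "eventually (\<lambda>k. (L2_norm (g k))\<^sup>2 \<le> B) sequentially" and B: "0 \<le> B"
  shows "h \<in> L2" "(L2_norm h)\<^sup>2 \<le> B"
proof -
  note [measurable] = L2_measurable[OF g] h
  have "(\<integral>\<^sup>+x. ennreal ((norm (h x))\<^sup>2) \<partial>I01) \<le> (\<integral>\<^sup>+x. liminf (\<lambda>k. ennreal ((norm (g k x))\<^sup>2)) \<partial>I01)"
  proof (rule nn_integral_mono_AE)
    show "AE x in I01. ennreal ((norm (h x))\<^sup>2) \<le> liminf (\<lambda>k. ennreal ((norm (g k x))\<^sup>2))"
      using lim
    proof eventually_elim
      case (elim x)
      then have "(\<lambda>k. ennreal ((norm (g k x))\<^sup>2)) \<longlonglongrightarrow> ennreal ((norm (h x))\<^sup>2)"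
        by (intro tendsto_ennrealI tendsto_intros)
      from lim_imp_Liminf[OF sequentially_bot this] show ?case by simp
    qed
  qed
  also have "\<dots> \<le> liminf (\<lambda>k. \<integral>\<^sup>+x. ennreal ((norm (g k x))\<^sup>2) \<partial>I01)"
    by (rule nn_integral_liminf) measurable
  also have "\<dots> \<le> limsup (\<lambda>k. \<integral>\<^sup>+x. ennreal ((norm (g k x))\<^sup>2) \<partial>I01)"
    by (rule Liminf_le_Limsup) simp
  also have "\<dots> \<le> ennreal B"
  proof (rule Limsup_bounded)
    have "(\<integral>\<^sup>+x. ennreal ((norm (g k x))\<^sup>2) \<partial>I01) = ennreal ((L2_norm (g k))\<^sup>2)" for k
      unfolding L2_norm_sq by (rule nn_integral_eq_integral[OF L2_integrable_sq[OF g]]) simp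
    with b show "\<forall>\<^sub>F k in sequentially. (\<integral>\<^sup>+x. ennreal ((norm (g k x))\<^sup>2) \<partial>I01) \<le> ennreal B"
      by (auto elim!: eventually_mono intro: ennreal_leI)
  qed
  finally have fin: "(\<integral>\<^sup>+x. ennreal ((norm (h x))\<^sup>2) \<partial>I01) \<le> ennreal B" .
  have i: "integrable I01 (\<lambda>x. (norm (h x))\<^sup>2)"
  proof (rule integrableI_bounded)
    show "(\<integral>\<^sup>+x. ennreal (norm ((norm (h x))\<^sup>2)) \<partial>I01) < \<infinity>"
      using order_le_less_trans[OF fin ennreal_less_top] by simp
  qed measurable
  then show "h \<in> L2" using h by (simp add: L2_def)
  show "(L2_norm h)\<^sup>2 \<le> B"
    using fin B nn_integral_eq_integral[OF i] unfolding L2_norm_sq by simp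
qed

text \<open>
  Along a subsequence the partial sums differ by at most \<open>2\<^sup>-\<^sup>k\<close> in norm at the \<open>k\<close>-th step, so their
  differences are almost everywhere absolutely summable and the subsequence has a pointwise limit.
  By Fatou's lemma the squared distance of the limit from each partial sum is at most the tail of
  the series of squared coefficients.
\<close>

theorem laguerre_Riesz_Fischer:
  fixes a :: "nat \<Rightarrow> complex"
  assumes a: "summable (\<lambda>n. (norm (a n))\<^sup>2)"
  shows "\<exists>f\<in>L2. (\<forall>n. laguerre_coeff f n = a n) \<and>
     (\<lambda>M. L2_norm (\<lambda>x. f x - laguerre_sum a {..<M} x)) \<longlonglongrightarrow> 0"
proof -
  let ?S = "\<lambda>N. laguerre_sum a {..<N}"
  have "\<exists>N. \<forall>p\<ge>N. \<forall>q. (\<Sum>n=p..<q. (norm (a n))\<^sup>2) < (1/4)^k" for k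
  proof -
    have "\<exists>N. \<forall>p\<ge>N. \<forall>q. norm (\<Sum>n=p..<q. (norm (a n))\<^sup>2) < (1/4)^k"
      using a unfolding summable_Cauchy by simp
    moreover have "norm (\<Sum>n=p..<q. (norm (a n))\<^sup>2) = (\<Sum>n=p..<q. (norm (a n))\<^sup>2)" for p q
      by (simp add: sum_nonneg)
    ultimately show ?thesis by (simp only:)
  qed
  then obtain N0 where N0: "\<And>k p q. N0 k \<le> p \<Longrightarrow> (\<Sum>n=p..<q. (norm (a n))\<^sup>2) < (1/4)^k"
    using choice[of "\<lambda>k N. \<forall>p\<ge>N. \<forall>q. (\<Sum>n=p..<q. (norm (a n))\<^sup>2) < (1/4)^k"] by blast
  \<comment> \<open>This subsequence is monotone, unbounded, and dominates the thresholds \<open>N0\<close>.\<close>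
  define N where "N k = k + (\<Sum>j\<le>k. N0 j)" for k
  have Nk: "k \<le> N k" for k by (simp add: N_def)
  have NSuc: "N k \<le> N (Suc k)" for k by (simp add: N_def)
  have NN0: "N0 k \<le> N k" for k
    using member_le_sum[of k "{..k}" N0] by (simp add: N_def)
  define d where "d k = laguerre_sum a {N k..<N (Suc k)}" for k
  have dL2: "d k \<in> L2" for k by (simp add: d_def L2_laguerre_sum)
  have dn: "(L2_norm (d k))\<^sup>2 \<le> ((1/2)^k)\<^sup>2" for k
  proof -
    have "((1/2)^k)\<^sup>2 = ((1/4::real)^k)"
      by (simp add: power_mult[symmetric] mult.commute[of k] power_divide) (simp add: power_mult)
    then show ?thesis using N0[OF NN0, of k "N (Suc k)"] by (simp add: d_def L2_norm_laguerre_sum)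
  qed
  have sumd: "AE x in I01. summable (\<lambda>k. d k x)"
  proof (rule AE_summable_of_integral_norm)
    show "integrable I01 (d k)" for k by (rule L2_integrable[OF dL2])
    \<comment> \<open>The measure is finite, so the L2 bound on the steps gives an L1 bound.\<close>
    show "(LINT x|I01. norm (d k x)) \<le> (1/2)^k" for k by (rule L2_norm1_bound[OF dL2 dn]) simp
  qed (simp add: summable_geometric)
  define f where "f x = ?S (N 0) x + (\<Sum>k. d k x)" for x
  have S_eq: "?S (N k) x = ?S (N 0) x + (\<Sum>j<k. d j x)" for k x
    by (induction k) (simp_all add: laguerre_sum_split[OF NSuc] d_def add.assoc)
  have fm: "f \<in> borel_measurable I01"
    unfolding f_def using L2_measurable[OF dL2] L2_measurable[OF L2_laguerre_sum] by measurable
  have lim: "AE x in I01. (\<lambda>k. ?S (N k) x) \<longlonglongrightarrow> f x"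
    using sumd
  proof eventually_elim
    case (elim x)
    then have "(\<lambda>k. ?S (N 0) x + (\<Sum>j<k. d j x)) \<longlonglongrightarrow> f x"
      unfolding f_def by (intro tendsto_add tendsto_const summable_LIMSEQ)
    moreover have "(\<lambda>k. ?S (N k) x) = (\<lambda>k. ?S (N 0) x + (\<Sum>j<k. d j x))"
      by (rule ext) (rule S_eq)
    ultimately show ?case by (simp only:)
  qed
  define tail where "tail M = (\<Sum>n. (norm (a n))\<^sup>2) - (\<Sum>n<M. (norm (a n))\<^sup>2)" for M
  have tail_ge: "(\<Sum>n=M..<q. (norm (a n))\<^sup>2) \<le> tail M" if "M \<le> q" for M q
  proof -
    have "(\<Sum>n<M. (norm (a n))\<^sup>2) + (\<Sum>n=M..<q. (norm (a n))\<^sup>2) = (\<Sum>n<q. (norm (a n))\<^sup>2)"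
      unfolding lessThan_atLeast0 by (rule sum.atLeastLessThan_concat) (use that in auto)
    also have "\<dots> \<le> (\<Sum>n. (norm (a n))\<^sup>2)" by (rule sum_le_suminf[OF a]) auto
    finally show ?thesis by (simp add: tail_def)
  qed
  have tail0: "tail \<longlonglongrightarrow> 0"
    using tendsto_diff[OF tendsto_const summable_LIMSEQ[OF a], of "\<Sum>n. (norm (a n))\<^sup>2"] by (simp add: tail_def[abs_def])
  have bound: "(\<lambda>x. f x - ?S M x) \<in> L2 \<and> (L2_norm (\<lambda>x. f x - ?S M x))\<^sup>2 \<le> tail M" for M
  proof -
    note F = L2_Fatou[where g = "\<lambda>k x. ?S (N k) x - ?S M x" and h = "\<lambda>x. f x - ?S M x" and B = "tail M"]
    have 1: "(\<lambda>x. ?S (N k) x - ?S M x) \<in> L2" for k by (intro L2_diff L2_laguerre_sum)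
    have 2: "(\<lambda>x. f x - ?S M x) \<in> borel_measurable I01"
      using fm L2_measurable[OF L2_laguerre_sum] by measurable
    have 3: "AE x in I01. (\<lambda>k. ?S (N k) x - ?S M x) \<longlonglongrightarrow> f x - ?S M x"
      using lim by eventually_elim (intro tendsto_intros)
    have 4: "\<forall>\<^sub>F k in sequentially. (L2_norm (\<lambda>x. ?S (N k) x - ?S M x))\<^sup>2 \<le> tail M"
      using eventually_ge_at_top[of M]
    proof eventually_elim
      case (elim k)
      then have MN: "M \<le> N k" using Nk[of k] by simp
      have "(\<lambda>x. ?S (N k) x - ?S M x) = laguerre_sum a {M..<N k}"
        by (rule ext) (simp add: laguerre_sum_split[OF MN])
      then show ?case using tail_ge[OF MN] by (simp add: L2_norm_laguerre_sum)
    qed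
    have 5: "0 \<le> tail M" using tail_ge[of M M] by simp
    show ?thesis using F[OF 1 2 3 4 5] by blast
  qed
  have f: "f \<in> L2" using bound[of 0] by (simp add: laguerre_sum_def)
  have lim0: "(\<lambda>M. L2_norm (\<lambda>x. f x - ?S M x)) \<longlonglongrightarrow> 0"
  proof (rule tendsto_sandwich[where f = "\<lambda>_. 0" and h = "\<lambda>M. sqrt (tail M)"])
    show "(\<lambda>M. sqrt (tail M)) \<longlonglongrightarrow> 0" using tendsto_real_sqrt[OF tail0] by simp
    show "\<forall>\<^sub>F M in sequentially. L2_norm (\<lambda>x. f x - ?S M x) \<le> sqrt (tail M)"
      using bound by (intro always_eventually allI real_le_rsqrt) auto
  qed (auto simp: L2_norm_nonneg)
  have "laguerre_coeff f n = a n" for n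
  proof -
    have "(\<lambda>M. L2_norm (\<lambda>x. f x - ?S M x) * L2_norm (laguerre n)) \<longlonglongrightarrow> 0"
      by (rule tendsto_mult_left_zero[OF lim0])
    moreover have "\<forall>\<^sub>F M in sequentially. norm (laguerre_coeff f n - a n) \<le> L2_norm (\<lambda>x. f x - ?S M x) * L2_norm (laguerre n)"
      using eventually_gt_at_top[of n]
    proof eventually_elim
      case (elim M)
      then have "laguerre_coeff f n - a n = laguerre_coeff f n - laguerre_coeff (?S M) n"
        by (simp add: laguerre_coeff_sum)
      also have "\<dots> = L2_inner (\<lambda>x. f x - ?S M x) (laguerre n)"
        unfolding laguerre_coeff_def by (simp add: L2_inner_diff_left f L2_laguerre L2_laguerre_sum)
      finally show ?case
        using L2_Cauchy_Schwarz[OF L2_diff[OF f L2_laguerre_sum] L2_laguerre] by simp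
    qed
    ultimately have "norm (laguerre_coeff f n - a n) \<le> 0"
      by (rule tendsto_lowerbound) simp
    then show ?thesis by simp
  qed
  with f lim0 show ?thesis by blast
qed

lemma L2_norm_cong:
  assumes "f \<doteq> g" "f \<in> L2" "g \<in> L2"
  shows "L2_norm f = L2_norm g"
proof -
  have "(LINT x|I01. (norm (f x))\<^sup>2) = (LINT x|I01. (norm (g x))\<^sup>2)"
  proof (rule integral_cong_AE)
    show "AE x in I01. (norm (f x))\<^sup>2 = (norm (g x))\<^sup>2"
      using assms(1) unfolding L2_eq_def by eventually_elim simp
  qed (use assms L2_integrable_sq in \<open>blast intro: borel_measurable_integrable\<close>)+
  then show ?thesis by (simp add: L2_norm_def)
qed

lemma laguerre_coeff_diff:
  "f \<in> L2 \<Longrightarrow> g \<in> L2 \<Longrightarrow> laguerre_coeff (\<lambda>x. f x - g x) n = laguerre_coeff f n - laguerre_coeff g n"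
  unfolding laguerre_coeff_def by (simp add: L2_inner_diff_left L2_laguerre)

lemma L2_eqI_laguerre_coeff:
  assumes "f \<in> L2" "g \<in> L2" "\<And>n. laguerre_coeff f n = laguerre_coeff g n"
  shows "f \<doteq> g"
proof -
  have "(\<lambda>x. f x - g x) \<doteq> (\<lambda>x. 0)"
    using assms by (intro laguerre_complete L2_diff) (simp_all add: laguerre_coeff_diff)
  then show ?thesis by (simp add: L2_eq_def)
qed

text \<open>
  By completeness \<open>f\<close> agrees with the function that the Riesz--Fischer theorem builds from its
  coefficients.
\<close>

lemma laguerre_expansion:
  assumes f: "f \<in> L2"
  shows "(\<lambda>M. L2_norm (\<lambda>x. f x - laguerre_sum (laguerre_coeff f) {..<M} x)) \<longlonglongrightarrow> 0"
proof -
  obtain g where g: "g \<in> L2" "\<And>n. laguerre_coeff g n = laguerre_coeff f n"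
    "(\<lambda>M. L2_norm (\<lambda>x. g x - laguerre_sum (laguerre_coeff f) {..<M} x)) \<longlonglongrightarrow> 0"
    using laguerre_Riesz_Fischer[OF laguerre_Bessel[OF f]] by blast
  have "g \<doteq> f" by (rule L2_eqI_laguerre_coeff) (simp_all add: f g)
  have "L2_norm (\<lambda>x. g x - laguerre_sum (laguerre_coeff f) {..<M} x) = L2_norm (\<lambda>x. f x - laguerre_sum (laguerre_coeff f) {..<M} x)" for M
    using \<open>g \<doteq> f\<close> by (intro L2_norm_cong L2_diff L2_laguerre_sum f g(1)) (auto simp: L2_eq_def)
  with g(3) show ?thesis by simp
qed

theorem laguerre_Parseval:
  assumes f: "f \<in> L2" and g: "g \<in> L2"
  shows "(\<lambda>n. laguerre_coeff f n * cnj (laguerre_coeff g n)) sums L2_inner f g"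
proof -
  let ?S = "\<lambda>M. laguerre_sum (laguerre_coeff f) {..<M}"
  have "(\<lambda>M. L2_inner f g - L2_inner (?S M) g) \<longlonglongrightarrow> 0"
  proof (rule Lim_null_comparison)
    show "(\<lambda>M. L2_norm (\<lambda>x. f x - ?S M x) * L2_norm g) \<longlonglongrightarrow> 0"
      by (rule tendsto_mult_left_zero[OF laguerre_expansion[OF f]])
    show "\<forall>\<^sub>F M in sequentially. norm (L2_inner f g - L2_inner (?S M) g) \<le> L2_norm (\<lambda>x. f x - ?S M x) * L2_norm g"
      using L2_Cauchy_Schwarz[OF L2_diff[OF f L2_laguerre_sum] g]
      by (simp add: L2_inner_diff_left f g L2_laguerre_sum)
  qed
  from tendsto_diff[OF tendsto_const this, of "L2_inner f g"]
  show ?thesis using g by (simp add: sums_def L2_inner_laguerre_sum)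
qed

section \<open>Adjoints of bounded operators\<close>

lemma L2_operator_closed: "L2_bounded_operator T \<Longrightarrow> f \<in> L2 \<Longrightarrow> T f \<in> L2"
  unfolding L2_bounded_operator_def by blast

lemma L2_operator_bound:
  assumes "L2_bounded_operator T"
  obtains K where "0 \<le> K" "\<And>f. f \<in> L2 \<Longrightarrow> L2_norm (T f) \<le> K * L2_norm f"
proof -
  obtain K where K: "\<And>f. f \<in> L2 \<Longrightarrow> L2_norm (T f) \<le> K * L2_norm f"
    using assms unfolding L2_bounded_operator_def by blast
  have "L2_norm (T f) \<le> \<bar>K\<bar> * L2_norm f" if "f \<in> L2" for f
    using K[OF that] mult_right_mono[OF abs_ge_self[of K] L2_norm_nonneg[of f]] by simp
  then show ?thesis using that[of "\<bar>K\<bar>"] by simp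
qed

lemma L2_operator_cong: "L2_bounded_operator T \<Longrightarrow> f \<in> L2 \<Longrightarrow> g \<in> L2 \<Longrightarrow> f \<doteq> g \<Longrightarrow> T f \<doteq> T g"
  unfolding L2_bounded_operator_def by blast

lemma L2_inner_operator_add:
  assumes T: "L2_bounded_operator T" and "f \<in> L2" "g \<in> L2" "y \<in> L2"
  shows "L2_inner (T (\<lambda>x. f x + c * g x)) y = L2_inner (T f) y + c * L2_inner (T g) y"
proof -
  note c = L2_operator_closed[OF T]
  have "\<forall>f\<in>L2. \<forall>g\<in>L2. T (\<lambda>x. f x + g x) \<doteq> (\<lambda>x. T f x + T g x)"
    and "\<forall>f\<in>L2. \<forall>c. T (\<lambda>x. c * f x) \<doteq> (\<lambda>x. c * T f x)"
    using T unfolding L2_bounded_operator_def by blast+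
  then have 1: "T (\<lambda>x. f x + c * g x) \<doteq> (\<lambda>x. T f x + T (\<lambda>x. c * g x) x)"
    and 2: "T (\<lambda>x. c * g x) \<doteq> (\<lambda>x. c * T g x)"
    by (auto simp: assms L2_cmult)
  have "L2_inner (T (\<lambda>x. f x + c * g x)) y = L2_inner (T f) y + L2_inner (T (\<lambda>x. c * g x)) y"
    using assms by (subst L2_inner_cong[OF 1]) (auto simp: L2_inner_add_left L2_add L2_cmult c)
  also have "L2_inner (T (\<lambda>x. c * g x)) y = c * L2_inner (T g) y"
    using assms by (subst L2_inner_cong[OF 2]) (auto simp: L2_inner_cmult_left L2_cmult c)
  finally show ?thesis .
qed

lemma L2_inner_operator_laguerre_sum:
  assumes T: "L2_bounded_operator T" and y: "y \<in> L2"
  shows "L2_inner (T (laguerre_sum a {..<N})) y = (\<Sum>n<N. a n * L2_inner (T (laguerre n)) y)"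
proof (induction N)
  case 0
  show ?case using L2_inner_operator_add[OF T L2_zero L2_zero y, of 1] by (simp add: laguerre_sum_def[abs_def])
next
  case (Suc N)
  have "laguerre_sum a {..<Suc N} = (\<lambda>x. laguerre_sum a {..<N} x + a N * laguerre N x)"
    by (rule ext) (simp add: laguerre_sum_def)
  then show ?case using L2_inner_operator_add[OF T L2_laguerre_sum L2_laguerre y] Suc.IH by simp
qed

text \<open>
  The coefficients of the adjoint vector must be \<open>b n\<close>, the conjugate of the inner product of the
  image of the \<open>n\<close>-th Laguerre function with \<open>y\<close>. They are square summable: testing \<open>T\<close> on the
  partial sum \<open>z\<close> of the series with coefficients \<open>b\<close> gives \<open>\<parallel>z\<parallel>\<^sup>2 \<le> K \<parallel>z\<parallel> \<parallel>y\<parallel>\<close>.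
\<close>

theorem L2_adjoint_exists:
  assumes T: "L2_bounded_operator T" and y: "y \<in> L2"
  shows "\<exists>x\<in>L2. \<forall>z\<in>L2. L2_inner (T z) y = L2_inner z x"
proof -
  obtain K where K: "0 \<le> K" "\<And>f. f \<in> L2 \<Longrightarrow> L2_norm (T f) \<le> K * L2_norm f"
    using L2_operator_bound[OF T] by blast
  have TK: "norm (L2_inner (T z) y) \<le> K * L2_norm z * L2_norm y" if "z \<in> L2" for z
    using L2_Cauchy_Schwarz[OF L2_operator_closed[OF T that] y] mult_right_mono[OF K(2)[OF that] L2_norm_nonneg[of y]]
    by simp
  define b where "b n = cnj (L2_inner (T (laguerre n)) y)" for n
  have "summable (\<lambda>n. (norm (b n))\<^sup>2)"
  proof (rule bounded_imp_summable)
    fix N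
    \<comment> \<open>\<open>A\<close> is both the inner product of \<open>T z\<close> with \<open>y\<close> and the squared norm of \<open>z\<close>.\<close>
    define A where "A = (\<Sum>n<Suc N. (norm (b n))\<^sup>2)"
    let ?z = "laguerre_sum b {..<Suc N}"
    have A0: "0 \<le> A" unfolding A_def by (intro sum_nonneg) simp
    have "L2_inner (T ?z) y = of_real A"
      unfolding L2_inner_operator_laguerre_sum[OF T y] A_def of_real_sum complex_norm_square
      by (intro sum.cong) (simp_all add: b_def)
    then have "A \<le> K * L2_norm ?z * L2_norm y"
      using TK[OF L2_laguerre_sum, of b "{..<Suc N}"] A0 by simp
    moreover have z: "(L2_norm ?z)\<^sup>2 = A"
      unfolding A_def by (simp add: L2_norm_laguerre_sum)
    ultimately have "L2_norm ?z * L2_norm ?z \<le> (K * L2_norm y) * L2_norm ?z"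
      by (simp add: power2_eq_square mult_ac)
    then have "L2_norm ?z \<le> K * L2_norm y"
      using L2_norm_nonneg[of ?z] K(1) L2_norm_nonneg[of y]
      by (cases "L2_norm ?z = 0") (auto simp: mult_le_cancel_right)
    then have "A \<le> (K * L2_norm y)\<^sup>2"
      unfolding z[symmetric] by (intro power_mono L2_norm_nonneg)
    then show "(\<Sum>n\<le>N. (norm (b n))\<^sup>2) \<le> (K * L2_norm y)\<^sup>2" by (simp add: A_def lessThan_Suc_atMost)
  qed simp
  then obtain x where x: "x \<in> L2" "\<And>n. laguerre_coeff x n = b n"
    using laguerre_Riesz_Fischer by blast
  have "L2_inner (T z) y = L2_inner z x" if z: "z \<in> L2" for z
  proof -
    let ?S = "\<lambda>N. laguerre_sum (laguerre_coeff z) {..<N}"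
    have S: "L2_inner (T (?S N)) y = (\<Sum>n<N. laguerre_coeff z n * cnj (laguerre_coeff x n))" for N
      by (simp add: L2_inner_operator_laguerre_sum[OF T y] x(2) b_def)
    have "(\<lambda>N. L2_inner (T z) y - L2_inner (T (?S N)) y) \<longlonglongrightarrow> 0"
    proof (rule Lim_null_comparison)
      show "(\<lambda>N. K * L2_norm (\<lambda>x. z x - ?S N x) * L2_norm y) \<longlonglongrightarrow> 0"
        by (intro tendsto_mult_left_zero tendsto_mult_right_zero laguerre_expansion z)
      show "\<forall>\<^sub>F N in sequentially. norm (L2_inner (T z) y - L2_inner (T (?S N)) y) \<le> K * L2_norm (\<lambda>x. z x - ?S N x) * L2_norm y"
        using TK[OF L2_diff[OF z L2_laguerre_sum]] L2_inner_operator_add[OF T z L2_laguerre_sum y, of "-1"] by simp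
    qed
    from tendsto_diff[OF tendsto_const this, of "L2_inner (T z) y"]
    have "(\<lambda>n. laguerre_coeff z n * cnj (laguerre_coeff x n)) sums L2_inner (T z) y"
      by (simp add: sums_def S)
    then show ?thesis using laguerre_Parseval[OF z x(1)] sums_unique2 by blast
  qed
  with x(1) show ?thesis by blast
qed

section \<open>The Hardy space in coordinates\<close>

lemma has_integral_exp_circle:
  fixes k :: int
  shows "((\<lambda>\<theta>. exp (\<i> * of_real \<theta>) powi k) has_integral (if k = 0 then 2 * pi else 0)) {0..2*pi}"
proof (cases "k = 0")
  case True
  then show ?thesis using has_integral_const_real[of "1::complex" 0 "2*pi"] by (simp add: scaleR_conv_of_real)
next
  case False
  have eq: "exp (\<i> * of_real \<theta>) powi k = exp (\<i> * of_int k * of_real \<theta>)" for \<theta> :: real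
    by (simp add: exp_power_int mult_ac)
  let ?F = "\<lambda>\<theta>::real. exp (\<i> * of_int k * of_real \<theta>) / (\<i> * of_int k)"
  have "((\<lambda>\<theta>. exp (\<i> * of_int k * of_real \<theta>)) has_integral ?F (2*pi) - ?F 0) {0..2*pi}"
  proof (rule fundamental_theorem_of_calculus)
    fix x :: real
    have "((\<lambda>z. exp (\<i> * of_int k * z) / (\<i> * of_int k)) has_field_derivative exp (\<i> * of_int k * of_real x)) (at (of_real x))"
      using False by (auto intro!: derivative_eq_intros)
    then have "((\<lambda>z. exp (\<i> * of_int k * z) / (\<i> * of_int k)) \<circ> of_real has_vector_derivative 1 * exp (\<i> * of_int k * of_real x)) (at x within {0..2*pi})"
      by (intro field_vector_diff_chain_within)
         (auto intro: has_vector_derivative_of_real has_field_derivative_at_within derivative_eq_intros)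
    then show "(?F has_vector_derivative exp (\<i> * of_int k * of_real x)) (at x within {0..2*pi})"
      by (simp add: o_def)
  qed simp
  moreover have "?F (2*pi) - ?F 0 = 0"
    using exp_integer_2pi[of "of_int k"] by (simp add: mult_ac)
  ultimately show ?thesis using False by (simp add: eq)
qed

lemma circle_integral_polynomial:
  fixes a :: "nat \<Rightarrow> complex"
  shows "((\<lambda>\<theta>. (norm (\<Sum>n<N. a n * (of_real r * exp (\<i> * of_real \<theta>)) ^ n))\<^sup>2) has_integral
     2 * pi * (\<Sum>n<N. (norm (a n))\<^sup>2 * r ^ (2 * n))) {0..2*pi}"
proof -
  let ?e = "\<lambda>\<theta>::real. exp (\<i> * of_real \<theta>)"
  have eq: "of_real ((norm (\<Sum>n<N. a n * (of_real r * ?e \<theta>) ^ n))\<^sup>2) =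
     (\<Sum>n<N. \<Sum>m<N. a n * cnj (a m) * of_real r ^ (n + m) * ?e \<theta> powi (int n - int m))" for \<theta>
  proof -
    have cnj_e: "cnj (?e \<theta>) = inverse (?e \<theta>)" by (simp add: exp_cnj exp_minus)
    have "of_real ((norm (\<Sum>n<N. a n * (of_real r * ?e \<theta>) ^ n))\<^sup>2) = 
      (\<Sum>n<N. a n * (of_real r * ?e \<theta>) ^ n) * cnj (\<Sum>n<N. a n * (of_real r * ?e \<theta>) ^ n)"
      by (rule complex_norm_square)
    also have "\<dots> = (\<Sum>n<N. \<Sum>m<N. (a n * (of_real r * ?e \<theta>) ^ n) * (cnj (a m) * (of_real r * inverse (?e \<theta>)) ^ m))"
      by (simp add: sum_product cnj_e)
    also have "\<dots> = (\<Sum>n<N. \<Sum>m<N. a n * cnj (a m) * of_real r ^ (n + m) * ?e \<theta> powi (int n - int m))"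
    proof (intro sum.cong refl)
      fix n m
      have "?e \<theta> powi (int n - int m) = ?e \<theta> ^ n * inverse (?e \<theta>) ^ m"
        by (simp add: power_int_diff divide_inverse power_inverse)
      then show "(a n * (of_real r * ?e \<theta>) ^ n) * (cnj (a m) * (of_real r * inverse (?e \<theta>)) ^ m) =
        a n * cnj (a m) * of_real r ^ (n + m) * ?e \<theta> powi (int n - int m)"
        by (simp only: power_mult_distrib power_add mult_ac)
    qed
    finally show ?thesis .
  qed
  have "((\<lambda>\<theta>. \<Sum>n<N. \<Sum>m<N. a n * cnj (a m) * of_real r ^ (n + m) * ?e \<theta> powi (int n - int m)) has_integral
     (\<Sum>n<N. \<Sum>m<N. a n * cnj (a m) * of_real r ^ (n + m) * (if int n - int m = 0 then 2 * pi else 0))) {0..2*pi}"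
    by (intro has_integral_sum finite_lessThan has_integral_mult_right has_integral_exp_circle)
  also have "(\<Sum>n<N. \<Sum>m<N. a n * cnj (a m) * of_real r ^ (n + m) * (if int n - int m = 0 then 2 * pi else 0)) =
     (\<Sum>n<N. \<Sum>m<N. if m = n then a n * cnj (a n) * of_real r ^ (2 * n) * (2 * pi) else 0)"
    by (intro sum.cong refl) (simp flip: mult_2)
  also have "\<dots> = (\<Sum>n<N. a n * cnj (a n) * of_real r ^ (2 * n) * (2 * pi))"
    by simp
  also have "\<dots> = of_real (2 * pi * (\<Sum>n<N. (norm (a n))\<^sup>2 * r ^ (2 * n)))"
  proof -
    have "of_real ((norm (a n))\<^sup>2 * r ^ (2 * n)) = a n * cnj (a n) * of_real r ^ (2 * n)" for n
      by (subst of_real_mult, subst complex_norm_square) simp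
    then show ?thesis
      by (subst of_real_mult, subst of_real_sum) (simp only: sum_distrib_left mult_ac)
  qed
  finally have "((\<lambda>\<theta>. complex_of_real ((norm (\<Sum>n<N. a n * (of_real r * ?e \<theta>) ^ n))\<^sup>2)) has_integral
     of_real (2 * pi * (\<Sum>n<N. (norm (a n))\<^sup>2 * r ^ (2 * n)))) {0..2*pi}"
    unfolding eq .
  from has_integral_Re[OF this] show ?thesis by simp
qed

text \<open>
  This is Parseval's identity on a circle. For the partial sums it is the orthogonality of the
  exponentials; on a circle of radius below 1 they are uniformly bounded, so dominated convergence
  applies.
\<close>

lemma circle_mean_power_series:
  fixes a :: "nat \<Rightarrow> complex"
  assumes \<phi>: "\<And>z. z \<in> ball 0 1 \<Longrightarrow> (\<lambda>n. a n * z ^ n) sums \<phi> z" and r: "0 < r" "r < 1"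
  shows "(\<lambda>n. (norm (a n))\<^sup>2 * r ^ (2 * n)) sums circle_mean \<phi> r"
proof -
  let ?z = "\<lambda>\<theta>::real. of_real r * exp (\<i> * of_real \<theta>)"
  obtain r' where r': "r < r'" "r' < 1" using r dense by blast
  have "summable (\<lambda>n. a n * of_real r' ^ n)"
    using \<phi>[of "of_real r'"] r r' by (auto simp: sums_iff)
  then have sm: "summable (\<lambda>n. norm (a n * of_real r ^ n))"
    by (rule powser_insidea) (use r r' in simp)
  define C where "C = (\<Sum>n. norm (a n * of_real r ^ n))"
  have z: "norm (?z \<theta>) = r" for \<theta> using r by (simp add: norm_mult)
  let ?P = "\<lambda>N \<theta>. (norm (\<Sum>n<N. a n * ?z \<theta> ^ n))\<^sup>2"
  note I = circle_integral_polynomial[of a r]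
  have "(\<lambda>N. integral {0..2*pi} (?P N)) \<longlonglongrightarrow> integral {0..2*pi} (\<lambda>\<theta>. (norm (\<phi> (?z \<theta>)))\<^sup>2)"
  proof (rule dominated_convergence(2))
    show "?P N integrable_on {0..2*pi}" for N using I by (rule has_integral_integrable)
    show "(\<lambda>\<theta>::real. C\<^sup>2) integrable_on {0..2*pi}" by (rule integrable_const_ivl)
    show "norm (?P N \<theta>) \<le> C\<^sup>2" for N \<theta>
    proof -
      have "norm (\<Sum>n<N. a n * ?z \<theta> ^ n) \<le> (\<Sum>n<N. norm (a n * ?z \<theta> ^ n))" by (rule norm_sum)
      also have "\<dots> = (\<Sum>n<N. norm (a n * of_real r ^ n))"
        using r by (simp only: norm_mult norm_power z) simp
      also have "\<dots> \<le> C" unfolding C_def by (rule sum_le_suminf[OF sm]) auto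
      finally show ?thesis by (simp add: power_mono)
    qed
    show "(\<lambda>N. ?P N \<theta>) \<longlonglongrightarrow> (norm (\<phi> (?z \<theta>)))\<^sup>2" for \<theta>
      using \<phi>[of "?z \<theta>"] z[of \<theta>] r unfolding sums_def by (intro tendsto_intros) simp
  qed
  then have "(\<lambda>N. 1 / (2 * pi) * (2 * pi * (\<Sum>n<N. (norm (a n))\<^sup>2 * r ^ (2 * n)))) \<longlonglongrightarrow> circle_mean \<phi> r"
    unfolding circle_mean_def by (intro tendsto_mult_left) (simp add: integral_unique[OF I])
  then show ?thesis by (simp add: sums_def)
qed

text \<open>
  By Parseval's identity the mean over a circle of radius \<open>r\<close> increases to the sum of the squared
  coefficients as \<open>r\<close> tends to 1, be it finite or not.
\<close>

lemma H2_disk_coeffs: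
  fixes a :: "nat \<Rightarrow> complex"
  assumes \<phi>: "\<And>z. z \<in> ball 0 1 \<Longrightarrow> (\<lambda>n. a n * z ^ n) sums \<phi> z"
  shows "\<phi> \<in> H2_disk \<longleftrightarrow> summable (\<lambda>n. (norm (a n))\<^sup>2)"
    and "\<phi> \<in> H2_disk \<Longrightarrow> (H2_disk_norm \<phi>)\<^sup>2 = (\<Sum>n. (norm (a n))\<^sup>2)"
proof -
  note S = circle_mean_power_series[OF \<phi>]
  have partial: "(\<Sum>n<N. (norm (a n))\<^sup>2) \<le> B" if B: "\<And>r. 0 < r \<Longrightarrow> r < 1 \<Longrightarrow> circle_mean \<phi> r \<le> B" for B N
  proof (rule tendsto_upperbound)
    have "((\<lambda>r. \<Sum>n<N. (norm (a n))\<^sup>2 * r ^ (2 * n)) \<longlongrightarrow> (\<Sum>n<N. (norm (a n))\<^sup>2 * 1 ^ (2 * n))) (at_left 1)"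
      by (intro tendsto_intros)
    then show "((\<lambda>r. \<Sum>n<N. (norm (a n))\<^sup>2 * r ^ (2 * n)) \<longlongrightarrow> (\<Sum>n<N. (norm (a n))\<^sup>2)) (at_left 1)" by simp
    have "(\<Sum>n<N. (norm (a n))\<^sup>2 * r ^ (2 * n)) \<le> B" if r: "r \<in> {0<..<1}" for r
    proof -
      have "(\<Sum>n<N. (norm (a n))\<^sup>2 * r ^ (2 * n)) \<le> circle_mean \<phi> r"
        using S[of r] r sum_le_suminf[of "\<lambda>n. (norm (a n))\<^sup>2 * r ^ (2 * n)" "{..<N}"] by (simp add: sums_iff)
      with B[of r] r show ?thesis by simp
    qed
    then show "\<forall>\<^sub>F r in at_left 1. (\<Sum>n<N. (norm (a n))\<^sup>2 * r ^ (2 * n)) \<le> B"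
      using eventually_at_left_real[of 0 1] by (auto elim: eventually_mono)
  qed simp
  have upper: "circle_mean \<phi> r \<le> (\<Sum>n. (norm (a n))\<^sup>2)" if "summable (\<lambda>n. (norm (a n))\<^sup>2)" "0 < r" "r < 1" for r
  proof (rule sums_le[OF _ S summable_sums])
    show "(norm (a n))\<^sup>2 * r ^ (2 * n) \<le> (norm (a n))\<^sup>2" for n
      using that by (intro mult_left_le power_le_one) auto
  qed (use that in auto)
  have hol: "\<phi> holomorphic_on ball 0 1"
    by (rule power_series_holomorphic[of 0 1 a]) (use \<phi> in simp)
  show iff: "\<phi> \<in> H2_disk \<longleftrightarrow> summable (\<lambda>n. (norm (a n))\<^sup>2)"
  proof
    assume "\<phi> \<in> H2_disk"
    then obtain B where "\<forall>r\<in>{0<..<1}. circle_mean \<phi> r \<le> B"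
      unfolding H2_disk_def bdd_above_def by auto
    then have B: "\<And>r. 0 < r \<Longrightarrow> r < 1 \<Longrightarrow> circle_mean \<phi> r \<le> B" by simp
    have "(\<Sum>n\<le>N. (norm (a n))\<^sup>2) \<le> B" for N
      using partial[OF B, of "Suc N"] by (simp add: lessThan_Suc_atMost)
    then show "summable (\<lambda>n. (norm (a n))\<^sup>2)"
      by (intro bounded_imp_summable[of _ B]) auto
  next
    assume s: "summable (\<lambda>n. (norm (a n))\<^sup>2)"
    show "\<phi> \<in> H2_disk" unfolding H2_disk_def using upper[OF s] hol
      by (auto intro!: bdd_aboveI[of _ "\<Sum>n. (norm (a n))\<^sup>2"])
  qed
  assume "\<phi> \<in> H2_disk"
  then have s: "summable (\<lambda>n. (norm (a n))\<^sup>2)" and bdd: "bdd_above (circle_mean \<phi> ` {0<..<1})"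
    using iff by (auto simp: H2_disk_def)
  have ne: "{0<..<1::real} \<noteq> {}" by simp
  have le: "(SUP r\<in>{0<..<1}. circle_mean \<phi> r) \<le> (\<Sum>n. (norm (a n))\<^sup>2)"
    using upper[OF s] by (intro cSUP_least ne) auto
  have ge: "(\<Sum>n. (norm (a n))\<^sup>2) \<le> (SUP r\<in>{0<..<1}. circle_mean \<phi> r)"
    by (intro suminf_le_const[OF s] partial cSUP_upper bdd) auto
  have "(\<Sum>n. (norm (a n))\<^sup>2) = (SUP r\<in>{0<..<1}. circle_mean \<phi> r)" using le ge by simp
  moreover have "0 \<le> (\<Sum>n. (norm (a n))\<^sup>2)" by (rule suminf_nonneg[OF s]) simp
  ultimately show "(H2_disk_norm \<phi>)\<^sup>2 = (\<Sum>n. (norm (a n))\<^sup>2)"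
    by (simp add: H2_disk_norm_def)
qed

lemma square_summable_power_series:
  fixes a :: "nat \<Rightarrow> complex"
  assumes a: "summable (\<lambda>n. (norm (a n))\<^sup>2)" and z: "z \<in> ball 0 1"
  shows "summable (\<lambda>n. a n * z ^ n)"
proof (rule summable_comparison_test')
  have "(norm z)\<^sup>2 < 1" using z by (simp add: abs_square_less_1)
  then have "summable (\<lambda>n. ((norm z)\<^sup>2) ^ n)" by (intro summable_geometric) simp
  with a show "summable (\<lambda>n. (norm (a n))\<^sup>2 + ((norm z)\<^sup>2) ^ n)" by (rule summable_add)
  show "norm (a n * z ^ n) \<le> (norm (a n))\<^sup>2 + ((norm z)\<^sup>2) ^ n" if "n \<ge> 0" for n
  proof -
    have "((norm z)\<^sup>2) ^ n = (norm z ^ n)\<^sup>2" by (simp only: power_mult[symmetric] mult.commute)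
    then show ?thesis
      using sum_squares_bound[of "norm (a n)" "norm z ^ n"] mult_nonneg_nonneg[OF norm_ge_zero[of "a n"] zero_le_power[OF norm_ge_zero[of z], of n]]
      unfolding norm_mult norm_power by linarith
  qed
qed

definition H2_coeffs :: "(complex \<Rightarrow> complex) \<Rightarrow> (nat \<Rightarrow> complex) \<Rightarrow> bool" where
  "H2_coeffs h a \<longleftrightarrow> summable (\<lambda>n. (norm (a n))\<^sup>2) \<and> (\<forall>s\<in>half_plane. (\<lambda>n. a n * lam s ^ n) sums h s)"

lemma lam_in_ball: "s \<in> half_plane \<Longrightarrow> lam s \<in> ball 0 1"
  by (rule bij_betw_apply[OF bij_betw_lam])

lemma lam_surj:
  assumes "z \<in> ball 0 1"
  shows "inv_into half_plane lam z \<in> half_plane" "lam (inv_into half_plane lam z) = z"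
  using assms bij_betw_imp_surj_on[OF bij_betw_lam] by (auto intro: inv_into_into f_inv_into_f)

lemma H2_half_plane_iff: "h \<in> H2_half_plane \<longleftrightarrow> (\<exists>a. H2_coeffs h a)"
proof
  assume "h \<in> H2_half_plane"
  then obtain \<phi> where \<phi>: "\<phi> \<in> H2_disk" and h: "\<And>s. s \<in> half_plane \<Longrightarrow> h s = \<phi> (lam s)"
    unfolding H2_half_plane_def by blast
  define a where "a n = (deriv ^^ n) \<phi> 0 / fact n" for n
  have a: "(\<lambda>n. a n * z ^ n) sums \<phi> z" if "z \<in> ball 0 1" for z
    using holomorphic_power_series[of \<phi> 0 1 z] \<phi> that by (simp add: H2_disk_def a_def)
  show "\<exists>a. H2_coeffs h a"
    using H2_disk_coeffs(1)[OF a] \<phi> h a lam_in_ball unfolding H2_coeffs_def by auto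
next
  assume "\<exists>a. H2_coeffs h a"
  then obtain a where a: "summable (\<lambda>n. (norm (a n))\<^sup>2)" "\<And>s. s \<in> half_plane \<Longrightarrow> (\<lambda>n. a n * lam s ^ n) sums h s"
    unfolding H2_coeffs_def by blast
  define \<phi> where "\<phi> z = (\<Sum>n. a n * z ^ n)" for z
  have "(\<lambda>n. a n * z ^ n) sums \<phi> z" if "z \<in> ball 0 1" for z
    unfolding \<phi>_def by (rule summable_sums[OF square_summable_power_series[OF a(1) that]])
  then have "\<phi> \<in> H2_disk" using H2_disk_coeffs(1) a(1) by blast
  moreover have "h s = \<phi> (lam s)" if "s \<in> half_plane" for s
    using a(2)[OF that] by (simp add: \<phi>_def sums_iff)
  ultimately show "h \<in> H2_half_plane" unfolding H2_half_plane_def by blast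
qed

lemma H2_half_plane_norm_coeffs:
  assumes "H2_coeffs h a"
  shows "(\<lambda>n. (norm (a n))\<^sup>2) sums (H2_half_plane_norm h)\<^sup>2"
proof -
  have a: "(\<lambda>n. a n * z ^ n) sums (h \<circ> inv_into half_plane lam) z" if "z \<in> ball 0 1" for z
    using assms lam_surj[OF that] unfolding H2_coeffs_def by fastforce
  have s: "summable (\<lambda>n. (norm (a n))\<^sup>2)" using assms by (simp add: H2_coeffs_def)
  then have "h \<circ> inv_into half_plane lam \<in> H2_disk" using H2_disk_coeffs(1)[OF a] by blast
  then have "(H2_half_plane_norm h)\<^sup>2 = (\<Sum>n. (norm (a n))\<^sup>2)"
    unfolding H2_half_plane_norm_def using H2_disk_coeffs(2)[OF a] by blast
  with s show ?thesis by (simp add: sums_iff)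
qed

lemma H2_coeffs_add:
  assumes "H2_coeffs g a" "H2_coeffs h b"
  shows "H2_coeffs (\<lambda>s. g s + c * h s) (\<lambda>n. a n + c * b n)"
  unfolding H2_coeffs_def
proof (intro conjI ballI)
  show "summable (\<lambda>n. (norm (a n + c * b n))\<^sup>2)"
  proof (rule summable_comparison_test')
    show "summable (\<lambda>n. 2 * (norm (a n))\<^sup>2 + 2 * (norm c)\<^sup>2 * (norm (b n))\<^sup>2)"
      using assms by (intro summable_add summable_mult) (auto simp: H2_coeffs_def)
    show "norm ((norm (a n + c * b n))\<^sup>2) \<le> 2 * (norm (a n))\<^sup>2 + 2 * (norm c)\<^sup>2 * (norm (b n))\<^sup>2" for n
    proof -
      have "(norm (a n + c * b n))\<^sup>2 \<le> (norm (a n) + norm (c * b n))\<^sup>2"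
        by (intro power_mono norm_triangle_ineq) auto
      also have "\<dots> \<le> 2 * (norm (a n))\<^sup>2 + 2 * (norm (c * b n))\<^sup>2"
        using sum_squares_bound[of "norm (a n)" "norm (c * b n)"] by (simp add: power2_sum)
      finally show ?thesis by (simp add: norm_mult power_mult_distrib)
    qed
  qed
  fix s assume "s \<in> half_plane"
  then have "(\<lambda>n. a n * lam s ^ n + c * (b n * lam s ^ n)) sums (g s + c * h s)"
    using assms by (intro sums_add sums_mult) (auto simp: H2_coeffs_def)
  then show "(\<lambda>n. (a n + c * b n) * lam s ^ n) sums (g s + c * h s)"
    by (simp add: algebra_simps)
qed

lemma complex_polarization:
  fixes z w :: complex
  shows "1 / 4 * (\<Sum>k<4. \<i> ^ k * of_real ((norm (z + \<i> ^ k * w))\<^sup>2)) = z * cnj w"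
proof -
  have 4: "{..<4::nat} = {0, 1, 2, 3}" by auto
  have "\<i> ^ 3 = - \<i>" by (simp add: power3_eq_cube)
  then show ?thesis
    unfolding 4 complex_norm_square by (simp add: algebra_simps)
qed

lemma H2_half_plane_inner_coeffs:
  assumes "H2_coeffs g a" "H2_coeffs h b"
  shows "(\<lambda>n. a n * cnj (b n)) sums H2_half_plane_inner g h"
proof -
  have "(\<lambda>n. 1 / 4 * (\<Sum>k<4. \<i> ^ k * complex_of_real ((norm (a n + \<i> ^ k * b n))\<^sup>2))) sums H2_half_plane_inner g h"
    unfolding H2_half_plane_inner_def
    by (intro sums_mult sums_sum sums_of_real H2_half_plane_norm_coeffs H2_coeffs_add assms)
  then show ?thesis unfolding complex_polarization .
qed

section \<open>The unitary \<open>U\<close> and the transferred operator\<close>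

text \<open>
  Apply Parseval's identity to the inner product of \<open>f\<close> and \<open>x\<close> to the power \<open>cnj s\<close>.
\<close>

lemma H2_coeffs_U:
  assumes f: "f \<in> L2"
  shows "H2_coeffs (U f) (laguerre_coeff f)"
  unfolding H2_coeffs_def
proof (intro conjI ballI laguerre_Bessel[OF f])
  fix s assume s: "s \<in> half_plane"
  have "cnj (laguerre_coeff (xpow (cnj s)) n) = lam s ^ n / (1 + s)" for n
    using s by (subst laguerre_coeff_xpow) (simp_all add: lam_def)
  then have "(\<lambda>n. (1 + s) * (laguerre_coeff f n * (lam s ^ n / (1 + s)))) sums U f s"
    using sums_mult[OF laguerre_Parseval[OF f L2_xpow[of "cnj s"]], of "1 + s"] s
    unfolding U_def L2_inner_xpow[OF f] by simp
  then show "(\<lambda>n. laguerre_coeff f n * lam s ^ n) sums U f s"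
    using half_plane_1[OF s] by simp
qed

lemma H2_coeffs_laguerre:
  assumes "h \<in> H2_half_plane"
  obtains y where "y \<in> L2" "H2_coeffs h (laguerre_coeff y)"
proof -
  obtain a where a: "H2_coeffs h a" using assms H2_half_plane_iff by blast
  then obtain y where "y \<in> L2" "\<And>n. laguerre_coeff y n = a n"
    using laguerre_Riesz_Fischer[of a] by (auto simp: H2_coeffs_def)
  then have "y \<in> L2" "laguerre_coeff y = a" by auto
  with a that show ?thesis by blast
qed

lemma H2_half_plane_inner_laguerre:
  assumes "x \<in> L2" "y \<in> L2" "H2_coeffs g (laguerre_coeff x)" "H2_coeffs h (laguerre_coeff y)"
  shows "H2_half_plane_inner g h = L2_inner x y"
  using H2_half_plane_inner_coeffs[OF assms(3,4)] laguerre_Parseval[OF assms(1,2)] by (rule sums_unique2)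

lemma H2_coeffs_eq_U:
  assumes "y \<in> L2" "H2_coeffs h (laguerre_coeff y)" "s \<in> half_plane"
  shows "h s = U y s"
  using assms H2_coeffs_U[OF assms(1)] unfolding H2_coeffs_def by (meson sums_unique2)

lemma L2_eqI_inner_laguerre:
  assumes "x \<in> L2" "y \<in> L2" "\<And>n. L2_inner (laguerre n) x = L2_inner (laguerre n) y"
  shows "x \<doteq> y"
  using assms by (intro L2_eqI_laguerre_coeff) (simp_all add: laguerre_coeff_def L2_inner_commute[of _ "laguerre _"])

lemma laguerre_coeff_cong: "f \<doteq> g \<Longrightarrow> f \<in> L2 \<Longrightarrow> g \<in> L2 \<Longrightarrow> laguerre_coeff f = laguerre_coeff g"
  unfolding laguerre_coeff_def by (rule ext) (rule L2_inner_cong; simp add: L2_laguerre)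

text \<open>
  The adjoint is chosen by a choice operator, so one has to show that a function with the defining
  property exists and that it is unique: \<open>y\<close> has it, and testing it on the Laguerre functions fixes
  all coefficients.
\<close>

lemma U_adj_laguerre:
  assumes y: "y \<in> L2" and h: "H2_coeffs h (laguerre_coeff y)"
  shows "U_adj h \<in> L2" "U_adj h \<doteq> y"
proof -
  have yP: "y \<in> L2 \<and> (\<forall>z\<in>L2. H2_half_plane_inner (U z) h = L2_inner z y)"
    using y h by (auto intro: H2_half_plane_inner_laguerre H2_coeffs_U)
  have "U_adj h \<in> L2 \<and> (\<forall>z\<in>L2. H2_half_plane_inner (U z) h = L2_inner z (U_adj h))"
    unfolding U_adj_def hilbert_adjoint_def by (rule someI[of _ y]) (rule yP)
  with yP show "U_adj h \<in> L2" "U_adj h \<doteq> y"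
    by (auto intro!: L2_eqI_inner_laguerre L2_laguerre)
qed

lemma hat_laguerre:
  assumes T: "L2_bounded_operator T" and y: "y \<in> L2" and h: "H2_coeffs h (laguerre_coeff y)"
  shows "H2_coeffs (hat T h) (laguerre_coeff (T y))"
proof -
  note u = U_adj_laguerre[OF y h]
  have "laguerre_coeff (T (U_adj h)) = laguerre_coeff (T y)"
    by (intro laguerre_coeff_cong L2_operator_cong[OF T] L2_operator_closed[OF T] u y)
  then show ?thesis
    using H2_coeffs_U[OF L2_operator_closed[OF T u(1)]] by (simp add: hat_def)
qed

text \<open>
  In Laguerre coordinates \<open>U\<close> is the identity, so the adjoint of the transferred operator acts as
  \<open>T\<^sup>*\<close> does: \<open>U x\<close> with \<open>x = T\<^sup>* y\<close> has the property that defines the adjoint at \<open>f\<close>, and any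
  function with this property has the coefficients of \<open>x\<close>.
\<close>

theorem hat_adj_eq:
  assumes T: "L2_bounded_operator T" and y: "y \<in> L2" and f: "H2_coeffs f (laguerre_coeff y)"
    and x: "x \<in> L2" and adj: "\<And>z. z \<in> L2 \<Longrightarrow> L2_inner (T z) y = L2_inner z x"
    and s: "s \<in> half_plane"
  shows "hat_adj T f s = U x s"
proof -
  let ?P = "\<lambda>k. k \<in> H2_half_plane \<and> (\<forall>h\<in>H2_half_plane. H2_half_plane_inner (hat T h) f = H2_half_plane_inner h k)"
  have inner: "H2_half_plane_inner (hat T h) f = L2_inner w x" if "w \<in> L2" "H2_coeffs h (laguerre_coeff w)" for h w
    using H2_half_plane_inner_laguerre[OF L2_operator_closed[OF T that(1)] y hat_laguerre[OF T that] f] adj[OF that(1)]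
    by simp
  have PU: "?P (U x)"
  proof (intro conjI ballI)
    show "U x \<in> H2_half_plane" using H2_coeffs_U[OF x] H2_half_plane_iff by blast
    fix h assume "h \<in> H2_half_plane"
    then obtain w where w: "w \<in> L2" "H2_coeffs h (laguerre_coeff w)" by (rule H2_coeffs_laguerre)
    show "H2_half_plane_inner (hat T h) f = H2_half_plane_inner h (U x)"
      unfolding inner[OF w] using H2_half_plane_inner_laguerre[OF w(1) x w(2) H2_coeffs_U[OF x]] by simp
  qed
  have k: "?P (hat_adj T f)" unfolding hat_adj_def hilbert_adjoint_def by (rule someI[of ?P, OF PU])
  then obtain v where v: "v \<in> L2" "H2_coeffs (hat_adj T f) (laguerre_coeff v)" using H2_coeffs_laguerre by blast
  have "L2_inner (laguerre n) v = L2_inner (laguerre n) x" for n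
  proof -
    let ?h = "U (laguerre n)"
    have h: "H2_coeffs ?h (laguerre_coeff (laguerre n))" by (rule H2_coeffs_U[OF L2_laguerre])
    then have "?h \<in> H2_half_plane" using H2_half_plane_iff by blast
    then have "H2_half_plane_inner (hat T ?h) f = H2_half_plane_inner ?h (hat_adj T f)" using k by blast
    then show ?thesis
      using inner[OF L2_laguerre h] H2_half_plane_inner_laguerre[OF L2_laguerre v(1) h v(2)] by simp
  qed
  then have "v \<doteq> x" by (rule L2_eqI_inner_laguerre[OF v(1) x])
  then have "laguerre_coeff v = laguerre_coeff x" by (rule laguerre_coeff_cong[OF _ v(1) x])
  with v(2) show ?thesis using H2_coeffs_eq_U[OF x _ s] by simp
qed

section \<open>Products of Mellin transforms\<close>

definition mellin :: "(real \<Rightarrow> complex) \<Rightarrow> complex \<Rightarrow> complex" where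
  "mellin f s = (LINT x|I01. f x * xpow s x)"

lemma U_eq_mellin: "U f s = (1 + s) * mellin f s"
  by (simp add: U_def mellin_def)

lemma L2_inner_xpow_mellin: "f \<in> L2 \<Longrightarrow> L2_inner f (xpow (cnj s)) = mellin f s"
  unfolding mellin_def by (rule L2_inner_xpow)

lemma mellin_xpow: "s \<in> half_plane \<Longrightarrow> t \<in> half_plane \<Longrightarrow> mellin (xpow s) t = 1 / (1 + s + t)"
  unfolding mellin_def xpow_add by (subst integral_xpow) (auto simp: half_plane_def add.assoc)

lemma mellin_cong: "f \<doteq> g \<Longrightarrow> f \<in> L2 \<Longrightarrow> g \<in> L2 \<Longrightarrow> s \<in> half_plane \<Longrightarrow> mellin f s = mellin g s"
  unfolding mellin_def by (rule L2_integral_cong) (auto intro: L2_xpow)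

lemma mellin_cmult: "mellin (\<lambda>x. c * f x) s = c * mellin f s"
  unfolding mellin_def by (simp add: mult.assoc)

lemma mellin_add: "f \<in> L2 \<Longrightarrow> g \<in> L2 \<Longrightarrow> s \<in> half_plane \<Longrightarrow> mellin (\<lambda>x. f x + g x) s = mellin f s + mellin g s"
  unfolding mellin_def by (simp add: distrib_right L2_integrable_mult L2_xpow)

lemma mellin_holomorphic:
  assumes "f \<in> L2"
  shows "mellin f holomorphic_on half_plane"
proof -
  have "U f \<in> H2_half_plane" using H2_coeffs_U[OF assms] H2_half_plane_iff by blast
  then obtain \<phi> where \<phi>: "\<phi> holomorphic_on ball 0 1" and U: "\<And>s. s \<in> half_plane \<Longrightarrow> U f s = \<phi> (lam s)"
    unfolding H2_half_plane_def H2_disk_def by blast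
  have nz: "s \<in> half_plane \<Longrightarrow> s + 1 \<noteq> 0" for s using half_plane_1[of s] by (simp add: add.commute)
  have "lam holomorphic_on half_plane"
    unfolding lam_def[abs_def] by (intro holomorphic_intros nz)
  then have "\<phi> \<circ> lam holomorphic_on half_plane"
    by (rule holomorphic_on_compose_gen[OF _ \<phi>]) (use lam_in_ball in blast)
  then have "(\<lambda>s. (\<phi> \<circ> lam) s / (s + 1)) holomorphic_on half_plane"
    by (intro holomorphic_intros nz)
  then show ?thesis
    by (rule holomorphic_transform) (use nz U in \<open>simp add: U_eq_mellin[symmetric] field_simps U_eq_mellin\<close>)
qed

lemma mellin_combination:
  assumes f: "f \<in> L2" and s: "s \<in> half_plane"
  shows "integrable I01 (\<lambda>x. f x * (u * xpow s x - (\<Sum>i\<le>n. v i * xpow (of_nat i) x)))"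
    and "(LINT x|I01. f x * (u * xpow s x - (\<Sum>i\<le>n. v i * xpow (of_nat i) x))) =
      u * mellin f s - (\<Sum>i\<le>n. v i * mellin f (of_nat i))"
proof -
  have eq: "f x * (u * xpow s x - (\<Sum>i\<le>n. v i * xpow (of_nat i) x)) =
    u * (f x * xpow s x) - (\<Sum>i\<le>n. v i * (f x * xpow (of_nat i) x))" for x
    by (simp add: right_diff_distrib sum_distrib_left mult_ac)
  have 1: "integrable I01 (\<lambda>x. u * (f x * xpow s x))"
    by (intro integrable_mult_right L2_integrable_mult f L2_xpow s)
  have 2: "integrable I01 (\<lambda>x. v i * (f x * xpow (of_nat i) x))" for i
    by (intro integrable_mult_right L2_integrable_mult f L2_xpow) simp
  show "integrable I01 (\<lambda>x. f x * (u * xpow s x - (\<Sum>i\<le>n. v i * xpow (of_nat i) x)))"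
    unfolding eq by (intro Bochner_Integration.integrable_diff Bochner_Integration.integrable_sum 1 2)
  show "(LINT x|I01. f x * (u * xpow s x - (\<Sum>i\<le>n. v i * xpow (of_nat i) x))) =
      u * mellin f s - (\<Sum>i\<le>n. v i * mellin f (of_nat i))"
    unfolding eq mellin_def
    by (subst Bochner_Integration.integral_diff[OF 1 Bochner_Integration.integrable_sum[OF 2]],
        subst Bochner_Integration.integral_sum[OF 2]) simp
qed

text \<open>
  The product of the two transforms at \<open>s\<close> is the double integral of \<open>(x y)\<^sup>s a(x) b(y)\<close>, linear in the
  function \<open>u \<mapsto> u\<^sup>s\<close>. The estimate is made first in \<open>y\<close> for fixed \<open>x\<close> and then in \<open>x\<close>, so that only
  single integrals occur.
\<close>

lemma mellin_product_approximation:
  assumes a: "a \<in> L2" and b: "b \<in> L2" and s: "s \<in> half_plane"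
    and c: "\<And>u. u \<in> {0<..1} \<Longrightarrow> norm (xpow s u - (\<Sum>i\<le>n. c i * xpow (of_nat i) u)) \<le> e"
  shows "norm (mellin a s * mellin b s - (\<Sum>i\<le>n. c i * (mellin a (of_nat i) * mellin b (of_nat i))))
    \<le> e * (LINT x|I01. norm (b x)) * (LINT x|I01. norm (a x))"
proof -
  have inner: "norm (mellin b s * xpow s x - (\<Sum>i\<le>n. (c i * mellin b (of_nat i)) * xpow (of_nat i) x))
     \<le> e * (LINT y|I01. norm (b y))" if x: "x \<in> {0<..1}" for x
  proof -
    have "norm (LINT y|I01. b y * (xpow s x * xpow s y - (\<Sum>i\<le>n. (c i * xpow (of_nat i) x) * xpow (of_nat i) y)))
       \<le> e * (LINT y|I01. norm (b y))"
    proof (rule integral_mult_norm_bound[OF L2_integrable[OF b] mellin_combination(1)[OF b s]])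
      fix y :: real assume y: "y \<in> {0<..1}"
      have xy: "x * y \<in> {0<..1}" using x y by (auto intro: mult_le_one)
      have "xpow z (x * y) = xpow z x * xpow z y" for z using x y by (intro xpow_mult) auto
      then show "norm (xpow s x * xpow s y - (\<Sum>i\<le>n. (c i * xpow (of_nat i) x) * xpow (of_nat i) y)) \<le> e"
        using c[OF xy] by (simp add: mult.assoc)
    qed
    then show ?thesis unfolding mellin_combination(2)[OF b s] by (simp add: mult_ac)
  qed
  have "norm (LINT x|I01. a x * (mellin b s * xpow s x - (\<Sum>i\<le>n. (c i * mellin b (of_nat i)) * xpow (of_nat i) x)))
    \<le> e * (LINT x|I01. norm (b x)) * (LINT x|I01. norm (a x))"
    by (rule integral_mult_norm_bound[OF L2_integrable[OF a] mellin_combination(1)[OF a s] inner])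
  then show ?thesis unfolding mellin_combination(2)[OF a s] by (simp add: mult_ac)
qed

text \<open>
  The naturals are a uniqueness set here: by the preceding estimate both sides are, for \<open>Re s > 0\<close>,
  limits of the same combinations of their values at naturals. For smaller \<open>Re s\<close> the power \<open>u\<^sup>s\<close> need not be
  continuous at 0, and analytic continuation takes over.
\<close>

theorem mellin_product_eq:
  assumes L: "a \<in> L2" "b \<in> L2" "a' \<in> L2" "b' \<in> L2"
    and eq: "\<And>n. mellin a (of_nat n) * mellin b (of_nat n) = mellin a' (of_nat n) * mellin b' (of_nat n)"
    and s: "s \<in> half_plane"
  shows "mellin a s * mellin b s = mellin a' s * mellin b' s"
proof -
  have right: "mellin a s * mellin b s = mellin a' s * mellin b' s" if s: "0 < Re s" for s
  proof -
    have sh: "s \<in> half_plane" using s by (simp add: half_plane_def)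
    define C where "C = (LINT x|I01. norm (b x)) * (LINT x|I01. norm (a x)) + (LINT x|I01. norm (b' x)) * (LINT x|I01. norm (a' x))"
    have C0: "0 \<le> C" unfolding C_def by (intro add_nonneg_nonneg mult_nonneg_nonneg integral_nonneg_AE) auto
    have cont: "continuous_on {0..1} (xpow s)" using continuous_on_xpow_ln[OF s, of 0] by simp
    have "norm (mellin a s * mellin b s - mellin a' s * mellin b' s) \<le> d" if d: "0 < d" for d
    proof -
      define e where "e = d / (C + 1)"
      have e: "0 < e" using d C0 by (simp add: e_def)
      obtain c :: "nat \<Rightarrow> complex" and n where c: "\<And>u. u \<in> {0<..1} \<Longrightarrow> norm (xpow s u - (\<Sum>i\<le>n. c i * xpow (of_nat i) u)) < e"
        using xpow_approximation[OF cont e] by blast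
      note approx = mellin_product_approximation[OF _ _ sh less_imp_le[OF c]]
      have "norm (mellin a s * mellin b s - mellin a' s * mellin b' s) \<le>
        e * (LINT x|I01. norm (b x)) * (LINT x|I01. norm (a x)) + e * (LINT x|I01. norm (b' x)) * (LINT x|I01. norm (a' x))"
        using norm_diff_triangle_le[OF approx[OF L(1,2)], of "mellin a' s * mellin b' s"] approx[OF L(3,4)]
        by (simp add: eq norm_minus_commute)
      also have "\<dots> = d * (C / (C + 1))" by (simp add: C_def e_def algebra_simps add_divide_distrib)
      also have "\<dots> \<le> d" using d C0 by (intro mult_left_le) auto
      finally show ?thesis .
    qed
    then show ?thesis using field_le_epsilon[of "norm (mellin a s * mellin b s - mellin a' s * mellin b' s)" 0] by simp
  qed
  show ?thesis
  proof (rule analytic_continuation_open[of "{s. 0 < Re s}" half_plane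
      "\<lambda>s. mellin a s * mellin b s" "\<lambda>s. mellin a' s * mellin b' s"])
    show "{s. 0 < Re s} \<noteq> {}" by (auto intro: exI[of _ 1])
    show "{s. 0 < Re s} \<subseteq> half_plane" by (auto simp: half_plane_def)
  qed (use L s right in \<open>auto intro!: holomorphic_intros mellin_holomorphic open_half_plane connected_half_plane open_halfspace_Re_gt\<close>)
qed

section \<open>Bounded quotients of holomorphic functions\<close>

text \<open>
  The zeros of \<open>B\<close> are isolated, and near each of them the quotient is bounded by 1, so it has no
  poles.
\<close>

lemma holomorphic_quotient_extension:
  assumes S: "open S" "connected S" and A: "A holomorphic_on S" and B: "B holomorphic_on S"
    and w: "w \<in> S" "B w \<noteq> 0" and le: "\<And>s. s \<in> S \<Longrightarrow> B s \<noteq> 0 \<Longrightarrow> norm (A s) \<le> norm (B s)"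
  obtains \<psi> where "\<psi> holomorphic_on S" "\<And>s. s \<in> S \<Longrightarrow> B s \<noteq> 0 \<Longrightarrow> \<psi> s = A s / B s"
    "\<And>s. s \<in> S \<Longrightarrow> norm (\<psi> s) \<le> 1"
proof
  define q where "q s = A s / B s" for s
  define \<psi> where "\<psi> = remove_sings q"
  have near: "\<forall>\<^sub>F s in at z. B s \<noteq> 0 \<and> s \<in> S" if "z \<in> S" for z
    using non_zero_neighbour_alt[OF B S that w] .
  have q1: "\<forall>\<^sub>F s in at z. norm (q s) \<le> 1" if "z \<in> S" for z
    using near[OF that] by eventually_elim (use le in \<open>auto simp: q_def norm_divide divide_le_eq_1\<close>)
  have mero: "q meromorphic_on S"
    unfolding q_def using A B S by (intro meromorphic_on_divide analytic_on_imp_meromorphic_on) (auto simp: analytic_on_open)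
  have an: "\<psi> analytic_on {z}" if z: "z \<in> S" for z
  proof (rule nicely_meromorphic_on_imp_analytic_at)
    show "\<psi> nicely_meromorphic_on S" unfolding \<psi>_def by (rule remove_sings_nicely_meromorphic[OF mero])
    have iso: "isolated_singularity_at q z"
      using mero z meromorphic_on_isolated_singularity meromorphic_on_subset by blast
    have "\<not> is_pole q z"
    proof
      assume "is_pole q z"
      then have "\<forall>\<^sub>F s in at z. 2 \<le> norm (q s)" unfolding is_pole_def filterlim_at_infinity[OF order_refl] by simp
      with q1[OF z] have "\<forall>\<^sub>F s in at z. False" by eventually_elim simp
      then show False by simp
    qed
    then show "\<not> is_pole \<psi> z"
      unfolding \<psi>_def using is_pole_cong[OF eventually_remove_sings_eq_at[OF iso] refl] by blast
  qed (rule z)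
  show "\<psi> holomorphic_on S"
    using an S(1) analytic_on_analytic_at analytic_on_open by blast
  show "\<psi> s = A s / B s" if s: "s \<in> S" "B s \<noteq> 0" for s
  proof -
    have "A analytic_on {s}" "B analytic_on {s}"
      using A B S s analytic_on_open analytic_on_analytic_at by blast+
    then have "q analytic_on {s}" unfolding q_def using s by (intro analytic_intros) auto
    then show ?thesis unfolding \<psi>_def by (simp add: q_def)
  qed
  show "norm (\<psi> s) \<le> 1" if s: "s \<in> S" for s
  proof (rule tendsto_upperbound)
    have "isCont \<psi> s" by (rule analytic_at_imp_isCont[OF an[OF s]])
    then show "((\<lambda>s. norm (\<psi> s)) \<longlongrightarrow> norm (\<psi> s)) (at s)" by (intro tendsto_norm) (simp add: isCont_def)
    have iso: "isolated_singularity_at q s"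
      using mero s meromorphic_on_isolated_singularity meromorphic_on_subset by blast
    show "\<forall>\<^sub>F x in at s. norm (\<psi> x) \<le> 1"
      using eventually_remove_sings_eq_at[OF iso] q1[OF s] unfolding \<psi>_def by eventually_elim simp
  qed simp
qed

text \<open>
  For \<open>w \<noteq> 0\<close> the real part of \<open>1 / w\<close> exceeds \<open>-1/2\<close> iff \<open>\<bar>w\<bar>\<^sup>2 + 2 Re w > 0\<close>, that is, iff \<open>\<bar>w + 1\<bar> > 1\<close>.
\<close>

lemma inverse_in_half_plane:
  assumes "1 < norm z"
  shows "1 / (z - 1) \<in> half_plane"
proof -
  have z1: "z \<noteq> 1" using assms by auto
  have "1 < (norm z)\<^sup>2" using assms by simp
  then have "0 < (norm (z - 1))\<^sup>2 + 2 * Re (z - 1)"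
    unfolding cmod_power2 by (simp add: power2_eq_square algebra_simps)
  moreover have "0 < (norm (z - 1))\<^sup>2" using z1 by simp
  moreover have "Re (1 / (z - 1)) = Re (z - 1) / (norm (z - 1))\<^sup>2"
    unfolding Re_divide' cmod_power2 by simp
  ultimately have "- 1 / 2 < Re (1 / (z - 1))" by (simp only: pos_less_divide_eq)
  then show ?thesis by (simp add: half_plane_def)
qed

section \<open>Monomial operators\<close>

text \<open>
  With \<open>U y = f\<close>, the value of \<open>U (T\<^sup>* y)\<close> at \<open>s\<close> is a multiple of the inner product of \<open>T\<^sup>* y\<close> with \<open>x\<^sup>t\<close>, where
  \<open>t = cnj s\<close>, hence of \<open>y\<close> with \<open>T(x\<^sup>t)\<close>. The latter is a multiple of a power, and the inner product of \<open>y\<close> with a power is,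
  up to a known factor, a value of \<open>f\<close>.
\<close>

theorem hat_adj_weighted_composition:
  assumes T: "L2_bounded_operator T" and \<beta>: "\<And>s. s \<in> half_plane \<Longrightarrow> \<beta> s \<in> half_plane"
    and Tx: "\<And>s. s \<in> half_plane \<Longrightarrow> T (xpow s) \<doteq> (\<lambda>x. (1 + \<beta> s) / (1 + s) * g s * xpow (\<beta> s) x)"
    and f: "f \<in> H2_half_plane" and s: "s \<in> half_plane"
  shows "hat_adj T f s = conj_refl g s * f (conj_refl \<beta> s)"
proof -
  obtain y where y: "y \<in> L2" "H2_coeffs f (laguerre_coeff y)" using f by (rule H2_coeffs_laguerre)
  obtain x where x: "x \<in> L2" "\<And>z. z \<in> L2 \<Longrightarrow> L2_inner (T z) y = L2_inner z x"
    using L2_adjoint_exists[OF T y(1)] by blast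
  define t where "t = cnj s"
  define b where "b = \<beta> t"
  have t: "t \<in> half_plane" using s by (simp add: t_def)
  have b: "b \<in> half_plane" unfolding b_def by (rule \<beta>[OF t])
  have "L2_inner (xpow t) x = L2_inner (T (xpow t)) y" using x(2)[OF L2_xpow[OF t]] by simp
  also have "\<dots> = (1 + b) / (1 + t) * g t * L2_inner (xpow b) y"
    using L2_inner_cong[OF Tx[OF t] L2_operator_closed[OF T L2_xpow[OF t]] L2_cmult[OF L2_xpow[OF \<beta>[OF t]]] y(1)]
    by (simp only: L2_inner_cmult_left b_def)
  finally have xt: "L2_inner (xpow t) x = (1 + b) / (1 + t) * g t * L2_inner (xpow b) y" .
  have "mellin x s = cnj (L2_inner (xpow t) x)"
    using L2_inner_xpow_mellin[OF x(1), of s] by (simp add: t_def L2_inner_commute[of x])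
  also have "\<dots> = (1 + cnj b) / (1 + s) * cnj (g t) * L2_inner y (xpow b)"
    unfolding xt by (simp add: t_def L2_inner_commute[of y])
  also have "L2_inner y (xpow b) = mellin y (cnj b)"
    using L2_inner_xpow_mellin[OF y(1), of "cnj b"] by simp
  finally have "U x s = cnj (g t) * U y (cnj b)"
    unfolding U_eq_mellin using half_plane_1[OF s] by (simp add: field_simps)
  moreover have "f (cnj b) = U y (cnj b)" by (rule H2_coeffs_eq_U[OF y]) (use b in simp)
  ultimately show ?thesis
    using hat_adj_eq[OF T y x s] by (simp add: conj_refl_def b_def t_def)
qed

text \<open>
  The function \<open>v\<close> is the conjugate of \<open>T\<^sup>*\<close> applied to the power with exponent \<open>cnj t\<close>. For \<open>t\<close> outside the half plane the
  claim is void; this case is included so that \<open>v\<close> can be chosen for all \<open>t\<close> at once.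
\<close>

lemma mellin_operator_representation:
  assumes T: "L2_bounded_operator T"
  obtains v where "v \<in> L2" "\<And>s. s \<in> half_plane \<Longrightarrow> t \<in> half_plane \<Longrightarrow> mellin (T (xpow s)) t = mellin v s"
proof (cases "t \<in> half_plane")
  case True
  then have "xpow (cnj t) \<in> L2" by (simp add: L2_xpow)
  then obtain w where w: "w \<in> L2" "\<And>z. z \<in> L2 \<Longrightarrow> L2_inner (T z) (xpow (cnj t)) = L2_inner z w"
    using L2_adjoint_exists[OF T] by blast
  show ?thesis
  proof (rule that)
    show "(\<lambda>x. cnj (w x)) \<in> L2" by (rule L2_cnj[OF w(1)])
    fix s assume s: "s \<in> half_plane"
    have "mellin (T (xpow s)) t = L2_inner (T (xpow s)) (xpow (cnj t))"
      using L2_inner_xpow_mellin[OF L2_operator_closed[OF T L2_xpow[OF s]]] by simp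
    also have "\<dots> = L2_inner (xpow s) w" by (rule w(2)[OF L2_xpow[OF s]])
    finally show "mellin (T (xpow s)) t = mellin (\<lambda>x. cnj (w x)) s"
      by (simp add: L2_inner_def mellin_def mult.commute)
  qed
qed (use that L2_zero in blast)

theorem monomial_operator_structure:
  assumes "monomial_operator T"
  shows "\<exists>\<beta> g. \<beta> holomorphic_on half_plane \<and> \<beta> ` half_plane \<subseteq> half_plane \<and> g \<in> H2_half_plane \<and>
    (\<forall>s\<in>half_plane. T (xpow s) \<doteq> (\<lambda>x. (1 + \<beta> s) / (1 + s) * g s * xpow (\<beta> s) x))"
proof -
  obtain c p where T: "L2_bounded_operator T" and p: "\<And>n. p n \<in> half_plane"
    and Tn: "\<And>n. T (xpow (of_nat n)) \<doteq> (\<lambda>x. c n * xpow (p n) x)"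
    using assms unfolding monomial_operator_def by blast
  have TL2: "T (xpow s) \<in> L2" if "s \<in> half_plane" for s
    by (rule L2_operator_closed[OF T L2_xpow[OF that]])
  define F where "F s t = mellin (T (xpow s)) t" for s t
  have "\<exists>v. v \<in> L2 \<and> (\<forall>s\<in>half_plane. t \<in> half_plane \<longrightarrow> F s t = mellin v s)" for t
    unfolding F_def by (rule mellin_operator_representation[OF T, of t]) blast
  then obtain v where v: "\<And>t. v t \<in> L2" and Fv: "\<And>s t. s \<in> half_plane \<Longrightarrow> t \<in> half_plane \<Longrightarrow> F s t = mellin (v t) s"
    by metis
  have Fhol: "(\<lambda>s. F s t) holomorphic_on half_plane" if "t \<in> half_plane" for t
    using mellin_holomorphic[OF v] by (rule holomorphic_transform) (simp add: Fv that)
  have Fn: "F (of_nat n) t = c n / (1 + p n + t)" if t: "t \<in> half_plane" for n t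
    unfolding F_def using mellin_cong[OF Tn TL2 L2_cmult[OF L2_xpow[OF p]] t] p t
    by (simp add: mellin_cmult mellin_xpow)
  show ?thesis
  proof (cases "\<exists>m. c m \<noteq> 0")
    case False
    \<comment> \<open>All monomials are mapped to zero, hence \<open>F = 0\<close>; any holomorphic self-map serves as \<open>\<beta>\<close>.\<close>
    have "T (xpow s) \<doteq> (\<lambda>x. (1 + s) / (1 + s) * 0 * xpow s x)" if s: "s \<in> half_plane" for s
    proof -
      have "F s t = 0" if t: "t \<in> half_plane" for t
      proof -
        have "mellin (v t) (of_nat n) = 0" for n using False Fn[OF t, of n] Fv[OF _ t, of "of_nat n"] by simp
        then have "v t \<doteq> (\<lambda>x. 0)" by (intro L2_zero_if_moments_zero v) (simp add: mellin_def)
        from mellin_cong[OF this v L2_zero s] show ?thesis by (simp add: Fv[OF s t] mellin_def)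
      qed
      then have "T (xpow s) \<doteq> (\<lambda>x. 0)"
        by (intro L2_zero_if_moments_zero TL2 s) (simp add: F_def mellin_def)
      then show ?thesis by simp
    qed
    moreover have "(\<lambda>s. 0) \<in> H2_half_plane" using H2_half_plane_iff[of "\<lambda>s. 0"]
      by (auto simp: H2_coeffs_def intro!: exI[of _ "\<lambda>n. 0"])
    ultimately show ?thesis by (intro exI[of _ "\<lambda>s. s"] exI[of _ "\<lambda>s. 0"]) auto
  next
    case True
    then obtain m where m: "c m \<noteq> 0" by blast
    let ?m = "of_nat m :: complex"
    have F_identity: "F s t * ((1 - t) * F s 1 + t * F s 0) = F s 0 * F s 1"
      if s: "s \<in> half_plane" and t: "t \<in> half_plane" for s t
    proof -
      \<comment> \<open>The second factor on the left is itself a Mellin transform in \<open>s\<close>.\<close>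
      define w where "w x = (1 - t) * v 1 x + t * v 0 x" for x
      have w: "w \<in> L2" unfolding w_def by (intro L2_add L2_cmult v)
      have mw: "mellin w s = (1 - t) * F s 1 + t * F s 0" if "s \<in> half_plane" for s
        unfolding w_def using that v by (simp add: mellin_add mellin_cmult L2_cmult Fv)
      have "mellin (v t) s * mellin w s = mellin (v 0) s * mellin (v 1) s"
      proof (rule mellin_product_eq[OF v w v v _ s])
        fix n
        have nz: "1 + p n \<noteq> 0" "1 + p n + 1 \<noteq> 0" "1 + p n + t \<noteq> 0"
          using half_plane_add[OF p, of 0 n] half_plane_add[OF p, of 1 n] half_plane_add[OF p t, of n] by simp_all
        have "F (of_nat n) t * ((1 - t) * F (of_nat n) 1 + t * F (of_nat n) 0) = F (of_nat n) 0 * F (of_nat n) 1"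
          unfolding Fn[OF t] Fn[OF half_plane_0] Fn[OF half_plane_one] using nz
          by (simp add: divide_simps) (simp add: algebra_simps)
        then show "mellin (v t) (of_nat n) * mellin w (of_nat n) = mellin (v 0) (of_nat n) * mellin (v 1) (of_nat n)"
          by (simp add: mw Fv t)
      qed
      then show ?thesis by (simp add: mw s Fv t)
    qed
    \<comment> \<open>Zeros of \<open>F s 0\<close> are excluded together with those of the denominator \<open>F s 1\<close>: the bound on \<open>\<psi>0\<close> is a contradiction with \<open>F s 0 = 0\<close>.\<close>
    define D where "D s = F s 1 * F s 0" for s
    have Dhol: "D holomorphic_on half_plane" unfolding D_def by (intro holomorphic_intros Fhol) simp_all
    have Dm: "D ?m \<noteq> 0"
      unfolding D_def Fn[OF half_plane_0] Fn[OF half_plane_one]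
      using m half_plane_add[OF p, of 0 m] half_plane_add[OF p, of 1 m] by simp
    define \<psi>0 where "\<psi>0 s = 2 - F s 0 / F s 1" for s
    have F\<psi>0: "F s t * (1 + t * (1 - \<psi>0 s)) = F s 0" if "s \<in> half_plane" "t \<in> half_plane" "D s \<noteq> 0" for s t
    proof -
      have F1: "F s 1 \<noteq> 0" using that by (simp add: D_def)
      have "F s t * (1 + t * (1 - \<psi>0 s)) * F s 1 = F s t * ((1 - t) * F s 1 + t * F s 0)"
        using F1 by (simp add: \<psi>0_def field_simps)
      also have "\<dots> = F s 0 * F s 1" by (rule F_identity) (use that in auto)
      finally show ?thesis using F1 by simp
    qed
    have \<psi>0_le: "norm (\<psi>0 s) \<le> 1" if s: "s \<in> half_plane" and D: "D s \<noteq> 0" for s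
    proof (rule ccontr)
      assume "\<not> norm (\<psi>0 s) \<le> 1"
      then have n: "1 < norm (\<psi>0 s)" by simp
      then have "\<psi>0 s \<noteq> 1" by auto
      then have "1 + 1 / (\<psi>0 s - 1) * (1 - \<psi>0 s) = 0" by (simp add: field_simps)
      then have "F s 0 = 0" using F\<psi>0[OF s inverse_in_half_plane[OF n] D] by simp
      with D show False by (simp add: D_def)
    qed
    obtain \<psi> where \<psi>: "\<psi> holomorphic_on half_plane" and \<psi>D: "\<And>s. s \<in> half_plane \<Longrightarrow> D s \<noteq> 0 \<Longrightarrow> \<psi> s = \<psi>0 s"
      and \<psi>_le: "\<And>s. s \<in> half_plane \<Longrightarrow> norm (\<psi> s) \<le> 1"
    proof (rule holomorphic_quotient_extension[OF open_half_plane connected_half_plane _ Dhol half_plane_of_nat Dm])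
      have AD: "(2 * F s 1 - F s 0) * F s 0 = \<psi>0 s * D s" if "D s \<noteq> 0" for s
        using that by (simp add: D_def \<psi>0_def field_simps)
      show "(\<lambda>s. (2 * F s 1 - F s 0) * F s 0) holomorphic_on half_plane"
        by (intro holomorphic_intros Fhol) simp_all
      show "norm ((2 * F s 1 - F s 0) * F s 0) \<le> norm (D s)" if "s \<in> half_plane" "D s \<noteq> 0" for s
        unfolding AD[OF that(2)] norm_mult using \<psi>0_le[OF that] by (intro mult_left_le_one_le) auto
      fix \<psi> assume "\<psi> holomorphic_on half_plane" "\<And>s. s \<in> half_plane \<Longrightarrow> norm (\<psi> s) \<le> 1"
        and q: "\<And>s. s \<in> half_plane \<Longrightarrow> D s \<noteq> 0 \<Longrightarrow> \<psi> s = (2 * F s 1 - F s 0) * F s 0 / D s"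
      moreover have "\<psi> s = \<psi>0 s" if "s \<in> half_plane" "D s \<noteq> 0" for s
        using q[OF that] AD[OF that(2)] that by simp
      ultimately show thesis using that by blast
    qed
    have \<psi>m: "\<psi> ?m = lam (p m)"
    proof -
      have nz: "p m + 1 \<noteq> 0" "2 + p m \<noteq> 0"
        using half_plane_add[OF p, of 0 m] half_plane_add[OF p, of 1 m] by (simp_all add: add.commute)
      have "\<psi> ?m = 2 - (c m / (1 + p m)) / (c m / (1 + p m + 1))"
        using \<psi>D[OF half_plane_of_nat Dm] by (simp add: \<psi>0_def Fn)
      also have "(c m / (1 + p m)) / (c m / (1 + p m + 1)) = (2 + p m) / (p m + 1)"
        using m by (simp add: add.commute)
      also have "2 - (2 + p m) / (p m + 1) = lam (p m)" using nz by (simp add: lam_def field_simps)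
      finally show ?thesis .
    qed
    have \<psi>_less: "\<psi> s \<in> ball 0 1" if s: "s \<in> half_plane" for s
    proof (rule ccontr)
      assume "\<psi> s \<notin> ball 0 1"
      then have 1: "norm (\<psi> s) = 1" using \<psi>_le[OF s] by simp
      then have "\<psi> constant_on half_plane"
        using maximum_modulus_principle[OF \<psi> open_half_plane connected_half_plane open_half_plane order_refl s] \<psi>_le by simp
      then have "\<psi> ?m = \<psi> s" using s half_plane_of_nat unfolding constant_on_def by metis
      then show False using 1 norm_lam[OF p, of m] by (simp add: \<psi>m)
    qed
    define \<beta> where "\<beta> s = \<psi> s / (1 - \<psi> s)" for s
    have \<beta>: "\<beta> s \<in> half_plane \<and> 1 - \<psi> s = 1 / (1 + \<beta> s)" if s: "s \<in> half_plane" for s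
    proof -
      define b where "b = inv_into half_plane lam (\<psi> s)"
      have b: "b \<in> half_plane" "lam b = \<psi> s" unfolding b_def using lam_surj[OF \<psi>_less[OF s]] by auto
      have "1 - \<psi> s = 1 / (1 + b)"
        unfolding b(2)[symmetric] lam_def using half_plane_1[OF b(1)] by (simp add: field_simps)
      moreover from this have "\<beta> s = b"
        unfolding \<beta>_def using half_plane_1[OF b(1)] by (simp add: b(2)[symmetric] lam_def add.commute)
      ultimately show ?thesis using b by simp
    qed
    have \<beta>hol: "\<beta> holomorphic_on half_plane"
      unfolding \<beta>_def
    proof (intro holomorphic_intros \<psi>)
      show "1 - \<psi> s \<noteq> 0" if "s \<in> half_plane" for s
      proof
        assume "1 - \<psi> s = 0"
        then have "\<psi> s = 1" by simp
        then show False using \<psi>_less[OF that] by simp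
      qed
    qed
    \<comment> \<open>At the zeros of \<open>D\<close>, where \<open>\<psi>0\<close> says nothing, the relation survives by continuation.\<close>
    have F\<psi>: "F s t * (1 + t * (1 - \<psi> s)) = F s 0" if s: "s \<in> half_plane" and t: "t \<in> half_plane" for s t
    proof (rule analytic_continuation_open[of "{s \<in> half_plane. D s \<noteq> 0}" half_plane "\<lambda>s. F s t * (1 + t * (1 - \<psi> s))" "\<lambda>s. F s 0"])
      have "open (half_plane \<inter> D -` (- {0}))"
        using Dhol by (intro continuous_open_preimage holomorphic_on_imp_continuous_on open_half_plane) auto
      also have "half_plane \<inter> D -` (- {0}) = {s \<in> half_plane. D s \<noteq> 0}" by auto
      finally show "open {s \<in> half_plane. D s \<noteq> 0}" .
      show "{s \<in> half_plane. D s \<noteq> 0} \<noteq> {}" using Dm half_plane_of_nat by blast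
      show "(\<lambda>s. F s t * (1 + t * (1 - \<psi> s))) holomorphic_on half_plane"
        by (intro holomorphic_intros Fhol t \<psi>)
      show "(\<lambda>s. F s 0) holomorphic_on half_plane" by (rule Fhol) simp
    qed (use s t F\<psi>0 \<psi>D open_half_plane connected_half_plane in auto)
    have "T (xpow s) \<doteq> (\<lambda>x. (1 + \<beta> s) / (1 + s) * U (v 0) s * xpow (\<beta> s) x)" if s: "s \<in> half_plane" for s
    proof -
      have b: "\<beta> s \<in> half_plane" using \<beta>[OF s] by simp
      have "(1 + \<beta> s) / (1 + s) * U (v 0) s = (1 + \<beta> s) * F s 0"
        using half_plane_1[OF s] by (simp add: U_eq_mellin Fv s)
      moreover have "T (xpow s) \<doteq> (\<lambda>x. (1 + \<beta> s) * F s 0 * xpow (\<beta> s) x)"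
      proof (rule L2_eqI_moments[OF TL2[OF s] L2_cmult[OF L2_xpow[OF b]]])
        fix n
        let ?t = "of_nat n :: complex"
        have nz: "1 + \<beta> s \<noteq> 0" "1 + \<beta> s + ?t \<noteq> 0"
          using half_plane_1[OF b] half_plane_add[OF b half_plane_of_nat] by auto
        have "F s ?t * (1 + ?t * (1 / (1 + \<beta> s))) = F s 0"
          using F\<psi>[OF s half_plane_of_nat] \<beta>[OF s] by simp
        then have "F s ?t = (1 + \<beta> s) * F s 0 * (1 / (1 + \<beta> s + ?t))"
          using nz by (simp add: field_simps)
        also have "\<dots> = mellin (\<lambda>x. (1 + \<beta> s) * F s 0 * xpow (\<beta> s) x) ?t"
          using b by (simp add: mellin_cmult mellin_xpow)
        finally show "(LINT x|I01. T (xpow s) x * xpow (of_nat n) x) = (LINT x|I01. (1 + \<beta> s) * F s 0 * xpow (\<beta> s) x * xpow (of_nat n) x)"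
          by (simp add: F_def mellin_def)
      qed
      ultimately show ?thesis by simp
    qed
    moreover have "U (v 0) \<in> H2_half_plane" using H2_coeffs_U[OF v] H2_half_plane_iff by blast
    ultimately show ?thesis using \<beta>hol \<beta> by (intro exI[of _ \<beta>] exI[of _ "U (v 0)"]) auto
  qed
qed

theorem theorem1p8:
  fixes T :: "(real \<Rightarrow> complex) \<Rightarrow> real \<Rightarrow> complex"
  assumes "monomial_operator T"
  shows "\<exists>\<beta> g. \<beta> holomorphic_on half_plane \<and> \<beta> ` half_plane \<subseteq> half_plane \<and> g \<in> H2_half_plane \<and>
    (\<forall>s\<in>half_plane. T (xpow s) \<doteq> (\<lambda>x. (1 + \<beta> s) / (1 + s) * g s * xpow (\<beta> s) x)) \<and>
    (\<forall>f\<in>H2_half_plane. \<forall>s\<in>half_plane. hat_adj T f s = conj_refl g s * f (conj_refl \<beta> s))"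
proof -
  obtain \<beta> g where \<beta>: "\<beta> holomorphic_on half_plane" "\<beta> ` half_plane \<subseteq> half_plane" and g: "g \<in> H2_half_plane"
    and T: "\<And>s. s \<in> half_plane \<Longrightarrow> T (xpow s) \<doteq> (\<lambda>x. (1 + \<beta> s) / (1 + s) * g s * xpow (\<beta> s) x)"
    using monomial_operator_structure[OF assms] by blast
  have "hat_adj T f s = conj_refl g s * f (conj_refl \<beta> s)" if "f \<in> H2_half_plane" "s \<in> half_plane" for f s
    using assms \<beta>(2) T that unfolding monomial_operator_def by (intro hat_adj_weighted_composition) auto
  with \<beta> g T show ?thesis by blast
qed

end
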